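(* Let $n=4$ or $n=3$, let $k\geq 0$ be an integer, let $c\in\mathbb{C}$, and let $w,p_{1},p_{2},\alpha_{1},\alpha_{2}$ be non-zero complex constants with $\alpha_{1}\neq\alpha_{2}$. Let $f$ be a transcendental entire function of finite order which is a solution of the differential-difference equation $$f^{n}(z)+wf^{n-1}(z)f'(z)+f^{(k)}(z+c)=p_{1}e^{\alpha_{1}z}+p_{2}e^{\alpha_{2}z}$$ and which satisfies $N(r,1/f)=S(r,f)$. Then $f$ must be of the form $f(z)=Ce^{az}$, where $a$ and $C$ are non-zero constants such that, for some $i,j\in\{1,2\}$ with $i\neq j$, one has $a=\alpha_{i}$, $na=\alpha_{j}$ and $C=(1+aw)^{-1/n}p_{j}^{1/n}$ (for some choice of the $n$-th roots).
   Context: Standard Nevanlinna theory notation: $T(r,f)$ is the characteristic function and $N(r,f)$ the (integrated) counting function of poles of a meromorphic function $f$, so $N(r,1/f)$ counts zeros of $f$. $S(r,f)$ denotes any quantity of growth $o(T(r,f))$ as $r\to\infty$ outside a set of finite linear measure. The order of growth is $\rho(f)=\limsup_{r\to\infty}\frac{\log^{+}T(r,f)}{\log r}$; finite order means $\rho(f)<\infty$. Here $f^{n}$ denotes the $n$-th power of $f$, and $f^{(k)}$ denotes the $k$-th derivative ($f^{(0)}=f$). *)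

theory Defs
  imports
    "HOL-Complex_Analysis.Complex_Analysis"
    "HOL-Library.Landau_Symbols"
begin

section \<open>Nevanlinna functionals\<close>

text \<open>
  The definitions below are meant for functions that are meromorphic on the whole plane. Poles are
  detected by the limit behaviour of \<open>f\<close>, so the value of \<open>f\<close> at a pole is immaterial. In
  particular \<open>\<lambda>z. 1 / f z\<close> has poles exactly at the zeros of a nonzero entire \<open>f\<close>.
\<close>

text \<open>Number of poles in the closed disc of radius \<open>r\<close>, counted with multiplicity.\<close>

definition pole_count :: "(complex \<Rightarrow> complex) \<Rightarrow> real \<Rightarrow> nat" where
  "pole_count f r = (\<Sum>z | cmod z \<le> r \<and> is_pole f z. nat (- zorder f z))"

text \<open>
  Integrated counting function of poles,
  $N(r,f) = \int_0^r \frac{n(t,f) - n(0,f)}{t}\,dt + n(0,f) \log r$.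
\<close>

definition nevanlinna_N :: "real \<Rightarrow> (complex \<Rightarrow> complex) \<Rightarrow> real" where
  "nevanlinna_N r f =
     integral {0..r} (\<lambda>t. (real (pole_count f t) - real (pole_count f 0)) / t)
     + real (pole_count f 0) * ln r"

text \<open>Here $\log^+ x = \max(0, \log x)$ is written as \<open>ln (max 1 x)\<close>.\<close>

definition log_plus :: "real \<Rightarrow> real" where
  "log_plus x = ln (max 1 x)"

definition proximity_m :: "real \<Rightarrow> (complex \<Rightarrow> complex) \<Rightarrow> real" where
  "proximity_m r f =
     1 / (2 * pi) * integral {0..2 * pi} (\<lambda>\<theta>. log_plus (cmod (f (complex_of_real r * cis \<theta>))))"

definition nevanlinna_T :: "real \<Rightarrow> (complex \<Rightarrow> complex) \<Rightarrow> real" where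
  "nevanlinna_T r f = proximity_m r f + nevanlinna_N r f"

definition growth_order :: "(complex \<Rightarrow> complex) \<Rightarrow> ereal" where
  "growth_order f = Limsup at_top (\<lambda>r. ereal (log_plus (nevanlinna_T r f) / ln r))"

text \<open>
  \<open>small_growth g f\<close> renders $g(r) = S(r,f)$. The filter is \<open>r \<rightarrow> \<infinity>\<close> restricted to the complement of
  an exceptional set of finite linear measure.
\<close>

definition small_growth :: "(real \<Rightarrow> real) \<Rightarrow> (complex \<Rightarrow> complex) \<Rightarrow> bool" where
  "small_growth g f \<longleftrightarrow>
     (\<exists>E \<in> lmeasurable. g \<in> o[inf at_top (principal (- E))](\<lambda>r. nevanlinna_T r f))"

definition transcendental_entire :: "(complex \<Rightarrow> complex) \<Rightarrow> bool" where
  "transcendental_entire f \<longleftrightarrow> f holomorphic_on UNIV \<and> \<not> (\<exists>p. \<forall>z. f z = poly p z)"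

end

theory Submission
  imports Defs "HOL-Real_Asymp.Real_Asymp"
begin

text \<open>
  Write \<open>m(r)\<close> for the mean of \<open>log\<^sup>+ |f|\<close> over the circle of radius \<open>r\<close>; for entire \<open>f\<close> it is the
  characteristic function. The proof compares growth rates directly, with no logarithmic derivative
  estimate.

  The solution has exponential type. Since \<open>f^n + w f^(n-1) f'\<close> is, up to the factor \<open>w/n\<close>, the
  derivative of \<open>exp (n z / w) f^n\<close> divided by \<open>exp (n z / w)\<close>, the equation can be integrated. If
  \<open>L(r)\<close> is the maximum of \<open>log\<^sup>+ |f|\<close> on the disc of radius \<open>r\<close>, this gives
  \<open>n L(r) \<le> D (r + 1) + L(r + B)\<close> with constants \<open>D\<close> and \<open>B\<close>
  (\<open>differential_difference_growth_step\<close>). Finite order makes \<open>L\<close> polynomially bounded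
  (\<open>finite_order_norm_bound\<close>), so iterating the inequality kills the term on the right geometrically and
  leaves \<open>L(r) = O(r)\<close> (\<open>exponential_type_of_growth_step\<close>).

  Few zeros make \<open>f\<close> nearly exponential at some scales. The characteristic function is now \<open>O(r)\<close>, so
  \<open>N(\<rho>, 1/f) \<le> \<delta> \<rho>\<close> for arbitrarily large \<open>\<rho>\<close>. Dividing \<open>f\<close> by the Blaschke product of
  its zeros in the disc of radius \<open>\<rho>\<close> leaves \<open>exp g\<close> with \<open>|f| \<le> |exp g|\<close>, and Jensen's formula
  reads \<open>Re (g 0) = const + N(\<rho>, 1/f)\<close> (\<open>entire_logarithmic_majorant\<close>). As \<open>Re g = O(\<rho>)\<close>,
  the Borel-Caratheodory inequality bounds the second derivative of \<open>g\<close> by \<open>O(1/\<rho>)\<close>; on a disc of radius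
  \<open>R = \<rho> / T\<close> with \<open>T\<close> large, \<open>g\<close> therefore differs from a linear function \<open>a z\<close> by at most \<open>\<epsilon> R\<close>, the constant
  term being small as well (\<open>exponential_majorant_at_some_scale\<close>). The slopes stay bounded; passing to a
  convergent subsequence gives one \<open>a\<close> and radii \<open>R m \<rightarrow> \<infinity>\<close> along which \<open>h(z) = f(z) exp (- a z)\<close> is at most
  \<open>exp (\<epsilon> (R m))\<close> (\<open>subexponential_after_exponential_factor\<close>).

  The equation now reads \<open>P(z) exp (n a z) + H(z) exp (a z) = p 1 exp (\<alpha> 1 z) + p 2 exp (\<alpha> 2 z)\<close> with \<open>P\<close> and \<open>H\<close>
  subexponential along the same radii. Exponentials with distinct exponents are linearly independent over
  such coefficients (\<open>exponentials_independent_over_subexponential\<close>). Hence \<open>{a, n a} = {\<alpha> 1, \<alpha> 2}\<close> and \<open>P\<close>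
  is the constant \<open>p j\<close> with \<open>\<alpha> j = n a\<close>. Since \<open>f^(n-1)\<close> divides \<open>P\<close>, \<open>f\<close> has no zeros, so \<open>h\<close> is
  a subexponential function without zeros, which is constant. Evaluating \<open>P = p j\<close> at \<open>0\<close> gives
  \<open>C^n (1 + a w) = p j\<close>.
\<close>

section \<open>Finite Blaschke products and the logarithmic majorant\<close>

text \<open>
  For \<open>|a| < \<rho>\<close>, a conformal map of the disc of radius \<open>\<rho>\<close> onto the unit disc with its zero at \<open>a\<close>.
\<close>

definition blaschke_factor :: "real \<Rightarrow> complex \<Rightarrow> complex \<Rightarrow> complex" where
  "blaschke_factor \<rho> a z = of_real \<rho> * (z - a) / (of_real (\<rho>\<^sup>2) - cnj a * z)"

lemma blaschke_denominator_nonzero: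
  assumes "cmod a < \<rho>" "cmod z \<le> \<rho>"
  shows "of_real (\<rho>\<^sup>2) - cnj a * z \<noteq> 0"
proof
  assume "of_real (\<rho>\<^sup>2) - cnj a * z = 0"
  hence "cmod (of_real (\<rho>\<^sup>2)) = cmod (cnj a * z)" by simp
  hence "\<rho>\<^sup>2 = cmod a * cmod z" by (simp only: norm_mult norm_of_real complex_mod_cnj abs_power2)
  also have "\<dots> \<le> cmod a * \<rho>" using assms by (intro mult_left_mono) auto
  also have "\<dots> < \<rho> * \<rho>" using assms norm_ge_zero[of a] by (intro mult_strict_right_mono) linarith+
  finally show False by (simp add: power2_eq_square)
qed

lemma blaschke_norm_identity:
  "(cmod (of_real (\<rho>\<^sup>2) - cnj a * z))\<^sup>2 - (\<rho> * cmod (z - a))\<^sup>2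
     = (\<rho>\<^sup>2 - (cmod a)\<^sup>2) * (\<rho>\<^sup>2 - (cmod z)\<^sup>2)"
  unfolding power_mult_distrib cmod_power2 by (simp add: power2_eq_square algebra_simps)

lemma norm_blaschke_factor_le_1:
  assumes "cmod a < \<rho>" "cmod z \<le> \<rho>"
  shows "cmod (blaschke_factor \<rho> a z) \<le> 1"
proof -
  have \<rho>: "\<rho> > 0" using assms norm_ge_zero[of a] by linarith
  have "(cmod a)\<^sup>2 \<le> \<rho>\<^sup>2" "(cmod z)\<^sup>2 \<le> \<rho>\<^sup>2"
    using assms by (auto intro!: power_mono)
  hence "(\<rho> * cmod (z - a))\<^sup>2 \<le> (cmod (of_real (\<rho>\<^sup>2) - cnj a * z))\<^sup>2"
    using blaschke_norm_identity[of \<rho> a z] by (smt (verit) mult_nonneg_nonneg)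
  hence "\<rho> * cmod (z - a) \<le> cmod (of_real (\<rho>\<^sup>2) - cnj a * z)"
    by (rule power2_le_imp_le) simp
  thus ?thesis using blaschke_denominator_nonzero[OF assms] \<rho>
    by (simp add: blaschke_factor_def norm_divide norm_mult del: of_real_power)
qed

lemma norm_blaschke_factor_eq_1:
  assumes "cmod a < \<rho>" "cmod z = \<rho>"
  shows "cmod (blaschke_factor \<rho> a z) = 1"
proof -
  have \<rho>: "\<rho> > 0" using assms norm_ge_zero[of a] by linarith
  have "(\<rho> * cmod (z - a))\<^sup>2 = (cmod (of_real (\<rho>\<^sup>2) - cnj a * z))\<^sup>2"
    using blaschke_norm_identity[of \<rho> a z] assms by simp
  hence "\<rho> * cmod (z - a) = cmod (of_real (\<rho>\<^sup>2) - cnj a * z)"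
    by (rule power2_eq_imp_eq) (use \<rho> in auto)
  thus ?thesis using blaschke_denominator_nonzero[of a \<rho> z] assms \<rho>
    by (simp add: blaschke_factor_def norm_divide norm_mult del: of_real_power)
qed

lemma not_constant_on_UNIV_of_zero:
  assumes "f z0 \<noteq> 0" "f z1 = 0"
  shows "\<not> f constant_on (UNIV :: complex set)"
  using assms unfolding constant_on_def by force

lemma finite_zeros_cball:
  fixes f :: "complex \<Rightarrow> complex"
  assumes "f holomorphic_on UNIV" "f z0 \<noteq> 0"
  shows "finite {z. cmod z \<le> r \<and> f z = 0}"
proof (cases "\<exists>z1. f z1 = 0")
  case True
  then obtain z1 where "f z1 = 0" by blast
  from holomorphic_compact_finite_zeros[OF assms(1) open_UNIV connected_UNIV compact_cball _ not_constant_on_UNIV_of_zero[of f, OF assms(2) this], of 0 r]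
  show ?thesis by (simp add: conj_commute)
qed auto

lemma zorder_entire:
  assumes "f holomorphic_on UNIV" "f z0 \<noteq> 0"
  shows "if f z = 0 then zorder f z > 0 else zorder f z = 0"
  using zorder_exist_zero[OF assms(1) open_UNIV connected_UNIV UNIV_I bexI[of "\<lambda>w. f w \<noteq> 0", OF assms(2) UNIV_I], of z] by auto

text \<open>
  The Blaschke product has the same zeros and orders as \<open>f\<close> on a disc slightly larger than that of
  radius \<open>\<rho>\<close>: no zero of \<open>f\<close> lies on the circle, and the poles of the Blaschke factors lie
  outside. The quotient is then holomorphic and zero-free on a convex domain and has a logarithm.
  The larger disc is needed to apply Cauchy's formula on the circle itself.
\<close>

lemma entire_eq_exp_times_blaschke_product:
  fixes f :: "complex \<Rightarrow> complex" and \<rho> :: real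
  assumes f: "f holomorphic_on UNIV" "f z0 \<noteq> 0" and \<rho>: "\<rho> > 0"
    and sphere: "\<And>z. cmod z = \<rho> \<Longrightarrow> f z \<noteq> 0"
  obtains g \<rho>' where "\<rho> < \<rho>'" "g holomorphic_on ball 0 \<rho>'"
    "\<And>z. z \<in> ball 0 \<rho>' \<Longrightarrow> f z = exp (g z) * (\<Prod>a | cmod a \<le> \<rho> \<and> f a = 0. blaschke_factor \<rho> a z ^ nat (zorder f a))"
proof -
  define Z where "Z = {a. cmod a \<le> \<rho> \<and> f a = 0}"
  define m where "m = (\<lambda>a. nat (zorder f a))"
  have finZ: "finite Z" unfolding Z_def by (rule finite_zeros_cball[OF f])
  have Zless: "cmod a < \<rho>" if "a \<in> Z" for a
    using that sphere[of a] unfolding Z_def by (cases "cmod a = \<rho>") auto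
  have m: "m a > 0" "int (m a) = zorder f a" if "a \<in> Z" for a
    using zorder_entire[OF f, of a] that unfolding Z_def m_def by auto
  define U where "U = ({z. f z \<noteq> 0} \<union> ball 0 \<rho>) \<inter> (\<Inter>a\<in>Z. {z. of_real (\<rho>\<^sup>2) - cnj a * z \<noteq> 0})"
  have contf: "continuous_on UNIV f" by (rule holomorphic_on_imp_continuous_on[OF f(1)])
  have "open U" unfolding U_def
    by (intro open_Int open_Un open_INT finZ ballI open_Collect_neq contf continuous_intros open_ball)
  moreover have "cball 0 \<rho> \<subseteq> U"
    using Zless blaschke_denominator_nonzero sphere unfolding U_def 
    by (force simp: le_less)
  ultimately obtain e where e: "e > 0" "(\<Union>x\<in>cball 0 \<rho>. cball x e) \<subseteq> U"
    using compact_subset_open_imp_cball_epsilon_subset[of "cball (0::complex) \<rho>" U] by auto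
  define \<rho>' where "\<rho>' = \<rho> + e"
  have sub: "ball 0 \<rho>' \<subseteq> U"
  proof
    fix z :: complex assume z: "z \<in> ball 0 \<rho>'"
    show "z \<in> U"
    proof (cases "cmod z \<le> \<rho>")
      case True thus ?thesis using \<open>cball 0 \<rho> \<subseteq> U\<close> by auto
    next
      case False
      \<comment> \<open>The radial projection of \<open>z\<close> to the circle lies within \<open>e\<close> of \<open>z\<close>.\<close>
      define x where "x = of_real (\<rho> / cmod z) * z"
      have "z \<noteq> 0" using False \<rho> by auto
      hence "cmod x = \<rho>" using \<rho> by (simp add: x_def norm_mult norm_divide)
      have "x - z = of_real (\<rho> / cmod z - 1) * z" by (simp add: x_def algebra_simps)
      hence "dist x z = \<bar>\<rho> / cmod z - 1\<bar> * cmod z" by (simp only: dist_norm norm_mult norm_of_real)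
      moreover have "\<rho> / cmod z \<le> 1" using False \<rho> by (intro divide_le_eq_1_pos[THEN iffD2]) auto
      hence "\<bar>\<rho> / cmod z - 1\<bar> = 1 - \<rho> / cmod z" by simp
      ultimately have "dist x z = (1 - \<rho> / cmod z) * cmod z" by simp
      also have "\<dots> = cmod z - \<rho>" using \<open>z \<noteq> 0\<close> by (simp add: left_diff_distrib)
      finally have "dist x z = cmod z - \<rho>" .
      hence "z \<in> cball x e" using z by (simp add: \<rho>'_def)
      with \<open>cmod x = \<rho>\<close> show ?thesis using e(2) by force
    qed
  qed
  have den: "of_real (\<rho>\<^sup>2) - cnj a * z \<noteq> 0" if "z \<in> ball 0 \<rho>'" "a \<in> Z" for a z
    using sub that unfolding U_def by auto
  have zeros: "f z = 0 \<longleftrightarrow> z \<in> Z" if "z \<in> ball 0 \<rho>'" for z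
    using sub that unfolding U_def Z_def by auto
  define B where "B = (\<lambda>z. \<Prod>a\<in>Z. blaschke_factor \<rho> a z ^ m a)"
  have hol_factor: "blaschke_factor \<rho> a holomorphic_on ball 0 \<rho>'" if "a \<in> Z" for a
    unfolding blaschke_factor_def using den that by (auto intro!: holomorphic_intros simp del: of_real_power)
  have factor_zero: "blaschke_factor \<rho> a z = 0 \<longleftrightarrow> z = a" if "z \<in> ball 0 \<rho>'" "a \<in> Z" for a z
    using den[OF that] \<rho> by (simp add: blaschke_factor_def del: of_real_power)
  have B_hol: "B holomorphic_on ball 0 \<rho>'"
    unfolding B_def by (intro holomorphic_intros hol_factor)
  have B_zero: "f z = 0 \<longleftrightarrow> B z = 0" if "z \<in> ball 0 \<rho>'" for z
    unfolding zeros[OF that] B_def using finZ factor_zero[OF that] m by auto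
  have B_zorder: "zorder B z = zorder f z" if z: "z \<in> ball 0 \<rho>'" for z
  proof (cases "z \<in> Z")
    case True
    have "zorder B z = int (m z)"
    proof (rule zorder_eqI[of "ball 0 \<rho>'" z "\<lambda>w. (of_real \<rho> / (of_real (\<rho>\<^sup>2) - cnj z * w)) ^ m z * (\<Prod>a\<in>Z-{z}. blaschke_factor \<rho> a w ^ m a)"])
      show "(\<lambda>w. (of_real \<rho> / (of_real (\<rho>\<^sup>2) - cnj z * w)) ^ m z * (\<Prod>a\<in>Z-{z}. blaschke_factor \<rho> a w ^ m a)) holomorphic_on ball 0 \<rho>'"
        using den True by (intro holomorphic_intros hol_factor) auto
      show "(of_real \<rho> / (of_real (\<rho>\<^sup>2) - cnj z * z)) ^ m z * (\<Prod>a\<in>Z-{z}. blaschke_factor \<rho> a z ^ m a) \<noteq> 0"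
        using den[OF z True] \<rho> finZ factor_zero[OF z] by (auto simp del: of_real_power)
      show "B w = (of_real \<rho> / (of_real (\<rho>\<^sup>2) - cnj z * w)) ^ m z * (\<Prod>a\<in>Z-{z}. blaschke_factor \<rho> a w ^ m a) * (w - z) powi int (m z)"
        if "w \<in> ball 0 \<rho>'" for w
        unfolding B_def prod.remove[OF finZ True]
        by (simp add: blaschke_factor_def power_divide power_mult_distrib)
    qed (use z in auto)
    thus ?thesis using m(2)[OF True] by simp
  next
    case False
    hence "B z \<noteq> 0" using B_zero zeros z by blast
    hence "zorder B z = 0" using zorder_eqI[of "ball 0 \<rho>'" z B B 0] B_hol z by auto
    moreover have "zorder f z = 0" using zorder_entire[OF f, of z] zeros[OF z] False by auto
    ultimately show ?thesis by simp
  qed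
  have f_hol: "f holomorphic_on ball 0 \<rho>'" using f(1) by (rule holomorphic_on_subset) auto
  obtain h where h: "h holomorphic_on ball 0 \<rho>'" "\<And>z. z \<in> ball 0 \<rho>' \<Longrightarrow> h z \<noteq> 0"
      "\<And>z. z \<in> ball 0 \<rho>' \<Longrightarrow> f z = h z * B z"
    by (rule holomorphic_zorder_factorization[OF f_hol open_ball connected_ball B_hol])
       (use B_zero B_zorder in auto)
  have "0 \<in> ball (0::complex) \<rho>'" using \<rho> e by (simp add: \<rho>'_def)
  then obtain g where "g holomorphic_on ball 0 \<rho>'" "\<And>z. z \<in> ball 0 \<rho>' \<Longrightarrow> exp (g z) = h z"
    using holomorphic_logarithm_exists[OF convex_ball open_ball h(1,2)] by blast
  thus ?thesis using h(3) e(1) that[of \<rho>' g] unfolding B_def Z_def m_def \<rho>'_def by auto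
qed

text \<open>
  This combines Jensen's formula with the Poisson-Jensen inequality. Blaschke factors have modulus at
  most one inside the circle and one on it, which gives both bounds on \<open>f\<close>. The value of \<open>Re (g 0)\<close> comes from comparing the
  leading Taylor coefficients of \<open>f\<close> and of the factorization at the origin; the sum over zeros is
  the integrated counting function \<open>N(\<rho>, 1/f)\<close>, as \<open>nevanlinna_N_reciprocal\<close> shows.
\<close>

lemma entire_logarithmic_majorant:
  fixes f :: "complex \<Rightarrow> complex" and \<rho> :: real
  assumes f: "f holomorphic_on UNIV" "f z0 \<noteq> 0" and \<rho>: "\<rho> > 0"
    and sphere: "\<And>z. cmod z = \<rho> \<Longrightarrow> f z \<noteq> 0"
  obtains g \<rho>' where "\<rho> < \<rho>'" "g holomorphic_on ball 0 \<rho>'"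
    "\<And>z. cmod z \<le> \<rho> \<Longrightarrow> cmod (f z) \<le> exp (Re (g z))"
    "\<And>z. cmod z = \<rho> \<Longrightarrow> cmod (f z) = exp (Re (g z))"
    "Re (g 0) = ln (cmod (zor_poly f 0 0)) +
       (\<Sum>a | cmod a \<le> \<rho> \<and> f a = 0. nat (zorder f a) * (if a = 0 then ln \<rho> else ln (\<rho> / cmod a)))"
proof -
  define Z where "Z = {a. cmod a \<le> \<rho> \<and> f a = 0}"
  define m where "m = (\<lambda>a. nat (zorder f a))"
  have finZ: "finite Z" unfolding Z_def by (rule finite_zeros_cball[OF f])
  have Zless: "cmod a < \<rho>" if "a \<in> Z" for a
    using that sphere[of a] unfolding Z_def by (cases "cmod a = \<rho>") auto
  obtain g \<rho>' where g: "\<rho> < \<rho>'" "g holomorphic_on ball 0 \<rho>'"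
    and feq: "\<And>z. z \<in> ball 0 \<rho>' \<Longrightarrow> f z = exp (g z) * (\<Prod>a\<in>Z. blaschke_factor \<rho> a z ^ m a)"
    using entire_eq_exp_times_blaschke_product[OF f \<rho> sphere] unfolding Z_def m_def by blast
  have le: "cmod (f z) \<le> exp (Re (g z))" if z: "cmod z \<le> \<rho>" for z
  proof -
    have "(\<Prod>a\<in>Z. cmod (blaschke_factor \<rho> a z ^ m a)) \<le> (\<Prod>a\<in>Z. 1)"
      using norm_blaschke_factor_le_1[OF Zless z]
      by (intro prod_mono) (auto simp: norm_power power_le_one)
    thus ?thesis using feq[of z] g(1) z by (simp add: norm_mult prod_norm)
  qed
  have eq: "cmod (f z) = exp (Re (g z))" if z: "cmod z = \<rho>" for z
    using feq[of z] g(1) z norm_blaschke_factor_eq_1[OF Zless z]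
    by (simp add: norm_mult norm_power flip: prod_norm)
  define P where "P = (\<lambda>w. \<Prod>a\<in>Z-{0}. blaschke_factor \<rho> a w ^ m a)"
  \<comment> \<open>This allows the factor \<open>(w / \<rho>) ^ m 0\<close> to be split off whether or not \<open>0\<close> is a zero.\<close>
  have m0: "m 0 = 0" if "0 \<notin> Z" 
    using zorder_entire[OF f, of 0] that \<rho> unfolding Z_def m_def by auto
  have prod_split: "(\<Prod>a\<in>Z. blaschke_factor \<rho> a w ^ m a) = (w / \<rho>) ^ m 0 * P w" for w
  proof -
    have b0: "blaschke_factor \<rho> 0 w = w / \<rho>" using \<rho> by (simp add: blaschke_factor_def power2_eq_square)
    show ?thesis
    proof (cases "0 \<in> Z")
      case True thus ?thesis using finZ by (simp add: P_def prod.remove b0)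
    next
      case False thus ?thesis using m0 by (simp add: P_def)
    qed
  qed
  define L where "L = zor_poly f 0"
  obtain r where r: "r > 0" "L holomorphic_on cball 0 r" "\<And>w. w \<in> cball 0 r \<Longrightarrow> f w = L w * w ^ m 0 \<and> L w \<noteq> 0"
    using zorder_exist_zero[OF f(1) open_UNIV connected_UNIV UNIV_I bexI[of "\<lambda>w. f w \<noteq> 0", OF f(2) UNIV_I], of 0, THEN conjunct2]
    unfolding L_def m_def diff_zero by blast
  have ev: "eventually (\<lambda>w. L w = exp (g w) * P w / of_real \<rho> ^ m 0) (at 0)"
  proof -
    have "eventually (\<lambda>w. w \<in> ball 0 (min r \<rho>) \<and> w \<noteq> 0) (at (0::complex))"
      using r(1) \<rho> by (auto simp: eventually_at dist_commute intro!: exI[of _ "min r \<rho>"])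
    thus ?thesis
    proof eventually_elim
      case (elim w)
      hence "L w * w ^ m 0 = exp (g w) * ((w / \<rho>) ^ m 0 * P w)"
        using r(3)[of w] feq[of w] prod_split[of w] g(1) by auto
      thus ?case using elim \<rho> by (simp add: power_divide field_simps)
    qed
  qed
  have "L \<midarrow>0\<rightarrow> L 0"
    using holomorphic_on_imp_continuous_on[OF r(2)] r(1)
    by (metis centre_in_ball continuous_on_interior interior_cball isCont_def)
  moreover have "(\<lambda>w. exp (g w) * P w / of_real \<rho> ^ m 0) \<midarrow>0\<rightarrow> exp (g 0) * P 0 / of_real \<rho> ^ m 0"
  proof -
    have gc: "isCont g 0" using g \<rho>
      by (intro continuous_on_interior[OF holomorphic_on_imp_continuous_on]) auto
    have "isCont (\<lambda>w. blaschke_factor \<rho> a w) 0" for a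
      using \<rho> unfolding blaschke_factor_def by (intro continuous_intros) auto
    hence "isCont P 0" unfolding P_def by (intro continuous_intros) auto
    hence "isCont (\<lambda>w. exp (g w) * P w / of_real \<rho> ^ m 0) 0"
      using gc \<rho> by (intro continuous_intros) auto
    thus ?thesis by (simp add: isCont_def)
  qed
  ultimately have L0: "L 0 = exp (g 0) * P 0 / of_real \<rho> ^ m 0"
    using tendsto_cong[OF ev] LIM_unique by blast
  have P0: "cmod (P 0) = (\<Prod>a\<in>Z-{0}. (cmod a / \<rho>) ^ m a)"
    using \<rho> unfolding P_def
    by (subst prod_norm[symmetric], intro prod.cong) (auto simp: norm_power blaschke_factor_def norm_mult norm_divide power2_eq_square)
  have P0pos: "(\<Prod>a\<in>Z-{0}. (cmod a / \<rho>) ^ m a) > 0"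
    using \<rho> by (intro prod_pos) auto
  have "ln (cmod (L 0)) = Re (g 0) + ln (\<Prod>a\<in>Z-{0}. (cmod a / \<rho>) ^ m a) - ln (\<rho> ^ m 0)"
    unfolding L0 using \<rho> P0pos P0 by (simp add: norm_mult norm_divide norm_power ln_mult ln_div)
  also have "ln (\<Prod>a\<in>Z-{0}. (cmod a / \<rho>) ^ m a) = (\<Sum>a\<in>Z-{0}. ln ((cmod a / \<rho>) ^ m a))"
    using \<rho> finZ by (subst ln_prod) auto
  also have "\<dots> = - (\<Sum>a\<in>Z-{0}. m a * ln (\<rho> / cmod a))"
    using \<rho> by (subst sum_negf[symmetric], intro sum.cong refl) (auto simp: ln_realpow ln_div algebra_simps)
  finally have "Re (g 0) = ln (cmod (L 0)) + (m 0 * ln \<rho> + (\<Sum>a\<in>Z-{0}. m a * ln (\<rho> / cmod a)))"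
    using \<rho> by (simp add: ln_realpow)
  also have "m 0 * ln \<rho> + (\<Sum>a\<in>Z-{0}. m a * ln (\<rho> / cmod a)) = (\<Sum>a\<in>Z. m a * (if a = 0 then ln \<rho> else ln (\<rho> / cmod a)))"
  proof (cases "0 \<in> Z")
    case True thus ?thesis using finZ by (simp add: sum.remove)
  next
    case False 
    hence "(\<Sum>a\<in>Z. m a * ln (\<rho> / cmod a)) = (\<Sum>a\<in>Z. m a * (if a = 0 then ln \<rho> else ln (\<rho> / cmod a)))"
      by (intro sum.cong) auto
    thus ?thesis using False m0 by simp
  qed
  finally have "Re (g 0) = ln (cmod (L 0)) + (\<Sum>a\<in>Z. m a * (if a = 0 then ln \<rho> else ln (\<rho> / cmod a)))" .
  thus ?thesis using that[OF g le eq] unfolding L_def Z_def m_def by blast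
qed

section \<open>Pointwise growth from the characteristic function\<close>

text \<open>
  Cauchy's formula at \<open>z\<close> for \<open>g(u) (R\<^sup>2 - |z|\<^sup>2) / (R\<^sup>2 - cnj z u)\<close>, which agrees with \<open>g\<close> at
  \<open>u = z\<close>. On the circle \<open>R\<^sup>2 = u cnj u\<close> turns the integrand into the Poisson kernel.
\<close>

lemma poisson_formula:
  fixes g :: "complex \<Rightarrow> complex" and z :: complex and R R' :: real
  assumes R: "0 < R" "R < R'" and g: "g holomorphic_on ball 0 R'" and z: "cmod z < R"
  shows "((\<lambda>t. of_real ((R\<^sup>2 - (cmod z)\<^sup>2) / (cmod (of_real R * cis t - z))\<^sup>2) * g (of_real R * cis t))
            has_integral (2 * pi * g z)) {0..2*pi}"
proof -
  define h where "h = (\<lambda>u. g u * of_real (R\<^sup>2 - (cmod z)\<^sup>2) / (of_real (R\<^sup>2) - cnj z * u))"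
  have den: "of_real (R\<^sup>2) - cnj z * u \<noteq> 0" if "u \<in> cball 0 R" for u
    using blaschke_denominator_nonzero[OF z] that by simp
  have "h holomorphic_on cball 0 R"
    unfolding h_def using den
    by (intro holomorphic_intros holomorphic_on_subset[OF g]) (use R in auto)
  from Cauchy_integral_circlepath_simple[OF this, of z] z
  have "((\<lambda>u. h u / (u - z)) has_contour_integral 2 * of_real pi * \<i> * h z) (part_circlepath 0 R 0 (2*pi))"
    by (simp add: circlepath_def)
  hence "((\<lambda>t. h (R * cis t) / (R * cis t - z) * R * \<i> * cis t) has_integral 2 * of_real pi * \<i> * h z) {0..2*pi}"
    by (subst (asm) has_contour_integral_part_circlepath_iff) auto
  from has_integral_mult_right[OF this, of "-\<i>"]
  have "((\<lambda>t. -\<i> * (h (R * cis t) / (R * cis t - z) * R * \<i> * cis t)) has_integral 2 * of_real pi * h z) {0..2*pi}"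
    by (simp add: algebra_simps)
  moreover have "h z = g z"
  proof -
    have "of_real (R\<^sup>2 - (cmod z)\<^sup>2) = of_real (R\<^sup>2) - cnj z * z"
      by (simp add: complex_norm_square mult.commute del: of_real_power)
    thus ?thesis using den[of z] z unfolding h_def by simp
  qed
  moreover have "-\<i> * (h (R * cis t) / (R * cis t - z) * R * \<i> * cis t)
      = of_real ((R\<^sup>2 - (cmod z)\<^sup>2) / (cmod (of_real R * cis t - z))\<^sup>2) * g (of_real R * cis t)" for t
  proof -
    define u where "u = of_real R * cis t"
    have u: "cmod u = R" using R by (simp add: u_def norm_mult)
    have "of_real (R\<^sup>2) = u * cnj u" using u by (metis complex_norm_square of_real_power)
    hence "of_real (R\<^sup>2) - cnj z * u = u * cnj (u - z)" by (simp add: algebra_simps)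
    hence hu: "h u = g u * of_real (R\<^sup>2 - (cmod z)\<^sup>2) / (u * cnj (u - z))" by (simp only: h_def)
    have "u \<noteq> 0" using u R by auto
    have "-\<i> * (X * R * \<i> * cis t) = X * u" for X :: complex by (simp add: u_def complex_eq_iff algebra_simps)
    hence "-\<i> * (h u / (u - z) * R * \<i> * cis t) = h u / (u - z) * u" .
    also have "\<dots> = of_real (R\<^sup>2 - (cmod z)\<^sup>2) / ((u - z) * cnj (u - z)) * g u"
      unfolding hu using \<open>u \<noteq> 0\<close> by (simp add: mult.commute)
    also have "(u - z) * cnj (u - z) = of_real ((cmod (u - z))\<^sup>2)"
      by (rule complex_norm_square[symmetric])
    finally show ?thesis unfolding u_def by (simp only: of_real_divide)
  qed
  ultimately show ?thesis by simp
qed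

lemma log_plus_nonneg: "log_plus x \<ge> 0"
  by (simp add: log_plus_def)

lemma continuous_on_log_plus: "continuous_on UNIV log_plus"
  unfolding log_plus_def by (intro continuous_intros) auto

lemma ln_le_log_plus: "x > 0 \<Longrightarrow> ln x \<le> log_plus x"
  by (simp add: log_plus_def)

lemma log_plus_circle_integrable:
  assumes "f holomorphic_on UNIV"
  shows "(\<lambda>t. log_plus (cmod (f (of_real r * cis t)))) integrable_on {a..b}"
  by (intro integrable_continuous_interval continuous_on_compose2[OF continuous_on_log_plus]
       continuous_on_compose2[OF holomorphic_on_imp_continuous_on[OF assms]] continuous_intros) auto

lemma proximity_nonneg: "proximity_m r f \<ge> 0"
proof (cases "(\<lambda>t. log_plus (cmod (f (of_real r * cis t)))) integrable_on {0..2*pi}")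
  case True
  thus ?thesis unfolding proximity_m_def by (intro mult_nonneg_nonneg integral_nonneg log_plus_nonneg) auto
next
  case False thus ?thesis unfolding proximity_m_def by (simp add: not_integrable_integral)
qed

text \<open>
  The Poisson kernel is at most \<open>(R + |z|) / (R - |z|) \<le> 3\<close> when \<open>|z| \<le> R/2\<close>.
\<close>

lemma log_norm_le_proximity:
  fixes f :: "complex \<Rightarrow> complex"
  assumes f: "f holomorphic_on UNIV" and R: "0 < R"
    and sphere: "\<And>z. cmod z = R \<Longrightarrow> f z \<noteq> 0" and z: "cmod z \<le> R / 2"
  shows "cmod (f z) \<le> exp (3 * proximity_m R f)"
proof -
  have "f (of_real R) \<noteq> 0" using sphere R by auto
  then obtain g R' where g: "R < R'" "g holomorphic_on ball 0 R'"
    "\<And>z. cmod z \<le> R \<Longrightarrow> cmod (f z) \<le> exp (Re (g z))"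
    "\<And>z. cmod z = R \<Longrightarrow> cmod (f z) = exp (Re (g z))"
    by (rule entire_logarithmic_majorant[OF f _ R sphere, of "of_real R"]) blast+
  define K where "K = (\<lambda>t. (R\<^sup>2 - (cmod z)\<^sup>2) / (cmod (of_real R * cis t - z))\<^sup>2)"
  have "((\<lambda>t. Re (of_real (K t) * g (of_real R * cis t))) has_integral Re (2 * pi * g z)) {0..2*pi}"
    unfolding K_def by (intro has_integral_Re poisson_formula[OF R g(1,2)]) (use z R in auto)
  hence int: "((\<lambda>t. K t * Re (g (of_real R * cis t))) has_integral (2 * pi * Re (g z))) {0..2*pi}"
    by simp
  have "2 * pi * Re (g z) \<le> integral {0..2*pi} (\<lambda>t. 3 * log_plus (cmod (f (of_real R * cis t))))"
  proof (rule has_integral_le[OF int])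
    show "((\<lambda>t. 3 * log_plus (cmod (f (of_real R * cis t)))) has_integral 
            integral {0..2*pi} (\<lambda>t. 3 * log_plus (cmod (f (of_real R * cis t))))) {0..2*pi}"
      by (intro integrable_integral integrable_on_mult_right log_plus_circle_integrable f)
    fix t :: real
    have u: "cmod (of_real R * cis t) = R" using R by (simp add: norm_mult)
    have "Re (g (of_real R * cis t)) = ln (cmod (f (of_real R * cis t)))"
      using g(4)[OF u] by simp
    also have "\<dots> \<le> log_plus (cmod (f (of_real R * cis t)))"
      using sphere[OF u] by (intro ln_le_log_plus) auto
    finally have le: "Re (g (of_real R * cis t)) \<le> log_plus (cmod (f (of_real R * cis t)))" .
    have d: "R - cmod z \<le> cmod (of_real R * cis t - z)" "0 < R - cmod z"
      using norm_triangle_ineq2[of "of_real R * cis t" z] u z R by auto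
    have "R\<^sup>2 - (cmod z)\<^sup>2 = (R - cmod z) * (R + cmod z)" by (simp add: power2_eq_square algebra_simps)
    also have "\<dots> \<le> (R - cmod z) * (3 * (R - cmod z))" using d z by (intro mult_left_mono) auto
    also have "\<dots> \<le> 3 * (cmod (of_real R * cis t - z))\<^sup>2" 
      using power_mono[OF d(1), of 2] d(2) unfolding power2_eq_square mult.left_commute[of _ 3] by simp
    finally have "K t \<le> 3" unfolding K_def using d
      by (simp add: divide_le_eq)
    moreover have "0 \<le> K t" unfolding K_def using z R power_mono[of "cmod z" R 2] by auto
    ultimately show "K t * Re (g (of_real R * cis t)) \<le> 3 * log_plus (cmod (f (of_real R * cis t)))"
      using order_trans[OF mult_left_mono[OF le] mult_right_mono[OF _ log_plus_nonneg]] by blast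
  qed
  hence "Re (g z) \<le> 3 * proximity_m R f"
    unfolding proximity_m_def using pi_gt_zero by (simp add: field_simps)
  hence "exp (Re (g z)) \<le> exp (3 * proximity_m R f)" by simp
  moreover have "cmod (f z) \<le> exp (Re (g z))" using g(3)[of z] z R by simp
  ultimately show ?thesis by linarith
qed

lemma nevanlinna_T_entire:
  assumes "f holomorphic_on UNIV"
  shows "nevanlinna_T r f = proximity_m r f"
proof -
  have "\<not> is_pole f z" for z using not_is_pole_holomorphic[OF open_UNIV UNIV_I assms] .
  hence "pole_count f = (\<lambda>_. 0)" by (simp add: pole_count_def fun_eq_iff)
  thus ?thesis by (simp add: nevanlinna_T_def nevanlinna_N_def)
qed

lemma zero_free_circle:
  fixes f :: "complex \<Rightarrow> complex" and a b :: real
  assumes "f holomorphic_on UNIV" "f z0 \<noteq> 0" "a < b"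
  obtains R where "a \<le> R" "R \<le> b" "\<And>z. cmod z = R \<Longrightarrow> f z \<noteq> 0"
proof -
  have "finite (cmod ` {z. cmod z \<le> b \<and> f z = 0})" using finite_zeros_cball[OF assms(1,2)] by blast
  hence "\<not> {a..b} \<subseteq> cmod ` {z. cmod z \<le> b \<and> f z = 0}"
    using infinite_Icc[OF assms(3)] finite_subset by blast
  thus ?thesis using that by force
qed

text \<open>
  Finite order bounds circle means of \<open>log\<^sup>+ |f|\<close> by a power of the radius; the inequality
  \<open>log_norm_le_proximity\<close> on a zero-free circle of radius about \<open>2 |z|\<close> turns this into a pointwise bound.
\<close>

lemma finite_order_norm_bound:
  fixes f :: "complex \<Rightarrow> complex"
  assumes f: "f holomorphic_on UNIV" "f z0 \<noteq> 0" and order: "growth_order f < \<infinity>"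
  obtains C :: real and K :: nat where "C \<ge> 0" "\<And>z. cmod (f z) \<le> exp (C * (1 + cmod z) ^ K)"
proof -
  obtain L :: real where "growth_order f < ereal L"
    using order ereal_dense2 by blast
  hence "eventually (\<lambda>r. ereal (log_plus (nevanlinna_T r f) / ln r) < ereal L) at_top"
    unfolding growth_order_def by (rule Limsup_lessD)
  hence "eventually (\<lambda>r. log_plus (proximity_m r f) / ln r < L) at_top"
    by (simp add: nevanlinna_T_entire[OF f(1)])
  then obtain r0 where r0: "\<And>r. r \<ge> r0 \<Longrightarrow> log_plus (proximity_m r f) / ln r < L"
    unfolding eventually_at_top_linorder by blast
  define r1 where "r1 = max r0 2"
  have r1: "r1 \<ge> 2" unfolding r1_def by simp
  define K where "K = nat \<lceil>\<bar>L\<bar>\<rceil>"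
  have K: "L \<le> real K" unfolding K_def by linarith
  have prox: "proximity_m r f \<le> r ^ K" if "r \<ge> r1" for r
  proof -
    have r: "r \<ge> 2" "r \<ge> r0" using that unfolding r1_def by auto
    have lnr: "ln r > 0" using r by simp
    have "log_plus (proximity_m r f) \<le> real K * ln r"
      using r0[OF r(2)] lnr K by (simp add: divide_less_eq) (smt (verit) mult_right_mono)
    hence "exp (log_plus (proximity_m r f)) \<le> exp (real K * ln r)" by simp
    also have "exp (real K * ln r) = r ^ K" using r by (simp add: exp_of_nat_mult)
    finally show ?thesis by (simp add: log_plus_def)
  qed
  show ?thesis
  proof
    show "(3 * (r1 + 3) ^ K :: real) \<ge> 0" unfolding r1_def by auto
    fix z
    obtain R where R: "2 * cmod z + r1 \<le> R" "R \<le> 2 * cmod z + r1 + 1" "\<And>u. cmod u = R \<Longrightarrow> f u \<noteq> 0"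
      using zero_free_circle[OF f, of "2 * cmod z + r1" "2 * cmod z + r1 + 1"] by auto
    have Rr: "R \<ge> r1" "R > 0" "cmod z \<le> R / 2" using R(1) norm_ge_zero[of z] r1 by linarith+
    have "cmod (f z) \<le> exp (3 * proximity_m R f)"
      by (rule log_norm_le_proximity[OF f(1) Rr(2) R(3) Rr(3)])
    also have "\<dots> \<le> exp (3 * R ^ K)" using prox[OF Rr(1)] by simp
    also have "R \<le> (r1 + 3) * (1 + cmod z)"
      using R(2) r1 mult_nonneg_nonneg[of "r1" "cmod z"] norm_ge_zero[of z]
      unfolding distrib_left distrib_right by linarith
    hence "exp (3 * R ^ K) \<le> exp (3 * ((r1 + 3) * (1 + cmod z)) ^ K)"
      using Rr by (simp add: power_mono)
    finally show "cmod (f z) \<le> exp (3 * (r1 + 3) ^ K * (1 + cmod z) ^ K)"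
      by (simp add: power_mult_distrib mult.assoc)
  qed
qed

section \<open>Solutions have exponential type\<close>

lemma norm_higher_deriv_shift_le:
  fixes f :: "complex \<Rightarrow> complex"
  assumes f: "f holomorphic_on UNIV" and bound: "\<And>u. cmod u \<le> cmod z + cmod c + 1 \<Longrightarrow> cmod (f u) \<le> X"
  shows "cmod ((deriv ^^ k) f (z + c)) \<le> fact k * X"
proof -
  have "cmod ((deriv ^^ k) f (z + c)) \<le> fact k * X / 1 ^ k"
  proof (rule Cauchy_inequality)
    show "f holomorphic_on ball (z + c) 1" using f by (rule holomorphic_on_subset) auto
    show "continuous_on (cball (z + c) 1) f"
      using holomorphic_on_imp_continuous_on[OF f] by (rule continuous_on_subset) auto
    fix u assume "cmod (z + c - u) = 1"
    hence "cmod u \<le> cmod z + cmod c + 1"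
      using norm_triangle_ineq2[of u "z + c"] norm_triangle_ineq[of z c] by (simp add: norm_minus_commute)
    thus "cmod (f u) \<le> X" by (rule bound)
  qed auto
  thus ?thesis by simp
qed

text \<open>
  With \<open>E(s) = exp (n s / w) f(s)^n\<close> the equation says \<open>E'(s) = (n/w) exp (n s / w) (rhs(s) - f^(k)(s + c))\<close>.
  Integrating from \<open>0\<close> to \<open>z\<close> and estimating the shifted derivative by Cauchy's inequality bounds the
  \<open>n\<close>-th power of \<open>|f|\<close> by its first power on a slightly larger disc. This gain of the exponent
  \<open>n\<close> is what drives the iteration below.
\<close>

lemma differential_difference_growth_step:
  fixes f rhs :: "complex \<Rightarrow> complex" and w c :: complex and n k :: nat and Q :: real
  assumes f: "f holomorphic_on UNIV" and w: "w \<noteq> 0" and Q: "Q \<ge> 0"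
    and eq: "\<And>z. f z ^ n + w * f z ^ (n - 1) * deriv f z + (deriv ^^ k) f (z + c) = rhs z"
    and rhs: "\<And>z. cmod (rhs z) \<le> exp (Q * (1 + cmod z))"
  obtains D :: real where "D \<ge> 0"
    "\<And>r X z. \<lbrakk>1 \<le> X; \<And>u. cmod u \<le> r + (cmod c + 1) \<Longrightarrow> cmod (f u) \<le> X; cmod z \<le> r\<rbrakk>
        \<Longrightarrow> cmod (f z) ^ n \<le> exp (D * (r + 1)) * X"
proof
  define M where "M = real n / cmod w"
  define F0 where "F0 = cmod (f 0) ^ n"
  \<comment> \<open>\<open>2 M\<close> pays for multiplying by \<open>exp (\<plusminus> n s / w)\<close>, \<open>Q\<close> for the right-hand side, and the rest bounds a factor linear in \<open>r\<close> by its exponential.\<close>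
  define D where "D = 2 * M + Q + F0 + M * (1 + fact k)"
  have M: "M \<ge> 0" and F0: "F0 \<ge> 0" by (auto simp: M_def F0_def)
  show "D \<ge> 0" unfolding D_def using M F0 Q by (intro add_nonneg_nonneg mult_nonneg_nonneg) auto
  fix r X :: real and z :: complex
  assume X: "1 \<le> X" and bound: "\<And>u. cmod u \<le> r + (cmod c + 1) \<Longrightarrow> cmod (f u) \<le> X" and z: "cmod z \<le> r"
  have r: "r \<ge> 0" using z norm_ge_zero[of z] by linarith
  define \<kappa> where "\<kappa> = of_nat n / w"
  have \<kappa>: "cmod \<kappa> = M" "\<kappa> * w = of_nat n" using w by (simp_all add: \<kappa>_def M_def norm_divide)
  define E where "E = (\<lambda>s. exp (\<kappa> * s) * f s ^ n)"
  define E' where "E' = (\<lambda>s. \<kappa> * exp (\<kappa> * s) * (rhs s - (deriv ^^ k) f (s + c)))"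
  have expM: "cmod (exp (\<kappa> * s)) \<le> exp (M * r)" "cmod (exp (- (\<kappa> * s))) \<le> exp (M * r)"
    if "cmod s \<le> r" for s
  proof -
    have "cmod (\<kappa> * s) \<le> M * r" 
      using that M by (simp add: norm_mult \<kappa> mult_left_mono)
    hence "\<bar>Re (\<kappa> * s)\<bar> \<le> M * r" using abs_Re_le_cmod order_trans by blast
    thus "cmod (exp (\<kappa> * s)) \<le> exp (M * r)" "cmod (exp (- (\<kappa> * s))) \<le> exp (M * r)"
      by (simp_all add: abs_le_iff)
  qed
  have der: "(E has_field_derivative E' s) (at s)" for s
  proof -
    have fd: "(f has_field_derivative deriv f s) (at s)"
      using holomorphic_derivI[OF f open_UNIV] by auto
    have "(E has_field_derivative (exp (\<kappa> * s) * (\<kappa>) * f s ^ n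
             + exp (\<kappa> * s) * (of_nat n * (deriv f s * f s ^ (n - 1))))) (at s)"
      unfolding E_def by (auto intro!: derivative_eq_intros fd simp: algebra_simps)
    moreover have "exp (\<kappa> * s) * (\<kappa>) * f s ^ n
             + exp (\<kappa> * s) * (of_nat n * (deriv f s * f s ^ (n - 1))) = E' s"
      unfolding E'_def eq[symmetric, of s] \<kappa>(2)[symmetric] by (simp add: algebra_simps)
    ultimately show ?thesis by simp
  qed
  have E'_bound: "cmod (E' s) \<le> M * exp (M * r) * (exp (Q * (1 + r)) + fact k * X)" if s: "cmod s \<le> r" for s
  proof -
    have "cmod (rhs s - (deriv ^^ k) f (s + c)) \<le> cmod (rhs s) + cmod ((deriv ^^ k) f (s + c))"
      by (rule norm_triangle_ineq4)
    also have "\<dots> \<le> exp (Q * (1 + r)) + fact k * X"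
    proof (rule add_mono)
      show "cmod (rhs s) \<le> exp (Q * (1 + r))"
        using rhs[of s] s Q by (meson add_left_mono exp_le_cancel_iff mult_left_mono order_trans)
      show "cmod ((deriv ^^ k) f (s + c)) \<le> fact k * X"
        by (rule norm_higher_deriv_shift_le[OF f bound]) (use s in auto)
    qed
    finally have "cmod (rhs s - (deriv ^^ k) f (s + c)) \<le> exp (Q * (1 + r)) + fact k * X" .
    thus ?thesis using expM(1)[OF s] M unfolding E'_def 
      by (auto simp: norm_mult \<kappa> intro!: mult_mono)
  qed
  have "cmod (E z - E 0) \<le> M * exp (M * r) * (exp (Q * (1 + r)) + fact k * X) * cmod (z - 0)"
    by (rule field_differentiable_bound[OF convex_cball[of 0 r], of E E'])
       (use der E'_bound z r in \<open>auto intro: has_field_derivative_at_within\<close>)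
  also have "\<dots> \<le> M * exp (M * r) * (exp (Q * (1 + r)) + fact k * X) * r"
    using z M X by (intro mult_left_mono) auto
  finally have "cmod (E z) \<le> F0 + M * exp (M * r) * (exp (Q * (1 + r)) + fact k * X) * r"
    using norm_triangle_ineq2[of "E z" "E 0"] by (simp add: E_def F0_def norm_power)
  also have "\<dots> \<le> exp (M * r) * exp (Q * (1 + r)) * X * (F0 + r * (M * (1 + fact k)))"
  proof -
    have e1: "exp (M * r) \<ge> 1" and e2: "exp (Q * (1 + r)) \<ge> 1" using M Q r by auto
    have "1 * 1 * 1 * F0 \<le> exp (M * r) * exp (Q * (1 + r)) * X * F0"
      using e1 e2 X F0 by (intro mult_mono mult_nonneg_nonneg) auto
    moreover have "exp (Q * (1 + r)) + fact k * X \<le> exp (Q * (1 + r)) * X * (1 + fact k)"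
    proof -
      have "exp (Q * (1 + r)) * 1 \<le> exp (Q * (1 + r)) * X" "1 * (fact k * X) \<le> exp (Q * (1 + r)) * (fact k * X)"
        using e1 e2 X by (intro mult_left_mono mult_right_mono; auto)+
      moreover have "exp (Q * (1 + r)) * X * (1 + fact k) = exp (Q * (1 + r)) * X + exp (Q * (1 + r)) * (fact k * X)"
        by (simp add: distrib_left)
      ultimately show ?thesis by linarith
    qed
    hence "(M * exp (M * r) * r) * (exp (Q * (1 + r)) + fact k * X) \<le> (M * exp (M * r) * r) * (exp (Q * (1 + r)) * X * (1 + fact k))"
      using M r by (intro mult_left_mono) auto
    ultimately show ?thesis by (simp add: algebra_simps)
  qed
  also have "\<dots> \<le> exp (M * r) * exp (Q * (1 + r)) * X * exp (F0 + r * (M * (1 + fact k)))"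
  proof (rule mult_left_mono)
    show "F0 + r * (M * (1 + fact k)) \<le> exp (F0 + r * (M * (1 + fact k)))"
      using exp_ge_add_one_self[of "F0 + r * (M * (1 + fact k))"] by linarith
  qed (use X in auto)
  finally have Ez: "cmod (E z) \<le> exp (M * r) * exp (Q * (1 + r)) * X * exp (F0 + r * (M * (1 + fact k)))" .
  have "f z ^ n = exp (- (\<kappa> * z)) * E z" by (simp add: E_def exp_minus field_simps)
  hence "cmod (f z) ^ n = cmod (exp (- (\<kappa> * z))) * cmod (E z)"
    by (metis norm_mult norm_power)
  also have "\<dots> \<le> exp (M * r) * (exp (M * r) * exp (Q * (1 + r)) * X * exp (F0 + r * (M * (1 + fact k))))"
    using expM(2)[OF z] Ez by (intro mult_mono) auto
  also have "\<dots> = exp (M * r + M * r + Q * (1 + r) + (F0 + r * (M * (1 + fact k)))) * X"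
    by (simp only: exp_add mult_ac)
  also have "\<dots> \<le> exp (D * (r + 1)) * X"
  proof -
    have "0 \<le> 2 * M + F0 * r + M * (1 + fact k)" using M F0 r by auto
    hence "M * r + M * r + Q * (1 + r) + (F0 + r * (M * (1 + fact k))) \<le> D * (r + 1)"
      unfolding D_def by (simp add: algebra_simps)
    thus ?thesis using X by (intro mult_right_mono) auto
  qed
  finally show "cmod (f z) ^ n \<le> exp (D * (r + 1)) * X" .
qed

text \<open>
  One application of the step sends a bound \<open>log |f| \<le> S(r)\<close> to \<open>log |f| \<le> (D (r + 1) + S(r + B)) / n\<close>. The
  linear function \<open>Y\<close> below is not increased by this operation because \<open>n \<ge> 2\<close>, while the polynomial excess
  over \<open>Y\<close> is halved each time, up to a shift of the radius that grows only linearly with the number of steps.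
\<close>

lemma exponential_type_of_growth_step:
  fixes f :: "complex \<Rightarrow> complex" and n K :: nat and B C D :: real
  assumes n: "n \<ge> 2" and nonneg: "B \<ge> 0" "C \<ge> 0" "D \<ge> 0"
    and a_priori: "\<And>z. cmod (f z) \<le> exp (C * (1 + cmod z) ^ K)"
    and step: "\<And>r X z. \<lbrakk>1 \<le> X; \<And>u. cmod u \<le> r + B \<Longrightarrow> cmod (f u) \<le> X; cmod z \<le> r\<rbrakk>
        \<Longrightarrow> cmod (f z) ^ n \<le> exp (D * (r + 1)) * X"
  shows "cmod (f z) \<le> exp (D * (1 + B) * (1 + cmod z))"
proof -
  define Y where "Y = (\<lambda>r. D * (r + 1) + D * B)"
  define S where "S = (\<lambda>m r. Y r + C * (r + 1 + real m * B) ^ K / 2 ^ m)"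
  have S_nonneg: "S m r \<ge> 0" if "r \<ge> 0" for m r
    unfolding S_def Y_def using that nonneg by (intro add_nonneg_nonneg mult_nonneg_nonneg divide_nonneg_nonneg zero_le_power) auto
  have iterate: "cmod (f z) \<le> exp (S m r)" if "cmod z \<le> r" for m r z
    using that
  proof (induction m arbitrary: r z)
    case 0
    have r: "r \<ge> 0" using 0 norm_ge_zero[of z] by linarith
    have "C * (1 + cmod z) ^ K \<le> C * (r + 1) ^ K" using 0 nonneg by (intro mult_left_mono power_mono) auto
    also have "\<dots> \<le> S 0 r" unfolding S_def Y_def using nonneg r by auto
    finally show ?case using a_priori[of z] by (meson exp_le_cancel_iff order_trans)
  next
    case (Suc m)
    have r: "r \<ge> 0" using Suc.prems norm_ge_zero[of z] by linarith
    have "cmod (f z) ^ n \<le> exp (D * (r + 1)) * exp (S m (r + B))"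
      by (rule step[OF _ _ Suc.prems]) (use Suc.IH S_nonneg[of "r + B" m] r nonneg in auto)
    also have "\<dots> = exp (2 * S (Suc m) r)"
      unfolding exp_add[symmetric] S_def Y_def by (simp add: algebra_simps)
    finally have le: "cmod (f z) ^ n \<le> exp (S (Suc m) r) ^ 2" by (simp add: exp_double)
    show ?case
    proof (rule ccontr)
      assume "\<not> cmod (f z) \<le> exp (S (Suc m) r)"
      hence gt: "cmod (f z) > exp (S (Suc m) r)" by simp
      have "exp (S (Suc m) r) \<ge> 1" using S_nonneg[OF r] by simp
      hence "1 \<le> cmod (f z)" using gt by linarith
      hence "cmod (f z) ^ n \<ge> cmod (f z) ^ 2" using n by (intro power_increasing) auto
      moreover have "cmod (f z) ^ 2 > exp (S (Suc m) r) ^ 2" using gt by (intro power_strict_mono) auto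
      ultimately show False using le by linarith
    qed
  qed
  have "(\<lambda>m. C * (cmod z + 1 + real m * B) ^ K / 2 ^ m) \<longlonglongrightarrow> 0"
  proof (rule tendsto_sandwich)
    show "\<forall>\<^sub>F m in sequentially. 0 \<le> C * (cmod z + 1 + real m * B) ^ K / 2 ^ m"
      using nonneg by (intro always_eventually allI divide_nonneg_nonneg mult_nonneg_nonneg zero_le_power) auto
    show "\<forall>\<^sub>F m in sequentially. C * (cmod z + 1 + real m * B) ^ K / 2 ^ m
        \<le> C * (cmod z + 1 + B) ^ K * ((1 + real m) ^ K / 2 ^ m)"
    proof (intro always_eventually allI)
      fix m
      have "cmod z + 1 + real m * B \<le> (cmod z + 1 + B) * (1 + real m)"
        using nonneg by (simp add: algebra_simps)
      hence "C * (cmod z + 1 + real m * B) ^ K \<le> C * ((cmod z + 1 + B) * (1 + real m)) ^ K"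
        using nonneg by (intro mult_left_mono power_mono) auto
      thus "C * (cmod z + 1 + real m * B) ^ K / 2 ^ m \<le> C * (cmod z + 1 + B) ^ K * ((1 + real m) ^ K / 2 ^ m)"
        by (simp add: power_mult_distrib divide_right_mono mult.assoc)
    qed
    have "(\<lambda>m. (1 + real m) ^ K / 2 ^ m) \<longlonglongrightarrow> 0" by real_asymp
    from tendsto_mult_left[OF this]
    show "(\<lambda>m. C * (cmod z + 1 + B) ^ K * ((1 + real m) ^ K / 2 ^ m)) \<longlonglongrightarrow> 0" by fastforce
  qed auto
  hence "(\<lambda>m. exp (S m (cmod z))) \<longlonglongrightarrow> exp (Y (cmod z) + 0)"
    unfolding S_def by (intro tendsto_intros)
  hence "cmod (f z) \<le> exp (Y (cmod z) + 0)"
    by (rule LIMSEQ_le_const) (use iterate in auto)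
  also have "\<dots> \<le> exp (D * (1 + B) * (1 + cmod z))"
    unfolding Y_def using nonneg by (simp add: algebra_simps)
  finally show ?thesis .
qed

section \<open>The counting function of the zeros\<close>

lemma eventually_nonzero_at_entire:
  assumes "f holomorphic_on UNIV" "f z0 \<noteq> 0"
  shows "eventually (\<lambda>w. f w \<noteq> 0) (at z)"
  using non_zero_neighbour_alt[OF assms(1) open_UNIV connected_UNIV UNIV_I UNIV_I assms(2), of z]
  by (auto elim: eventually_mono)

lemma is_pole_reciprocal_iff:
  assumes "f holomorphic_on UNIV" "f z0 \<noteq> 0"
  shows "is_pole (\<lambda>z. 1 / f z) a \<longleftrightarrow> f a = 0"
proof -
  have "f analytic_on {a}" using assms(1) by (metis analytic_on_open open_UNIV analytic_on_subset subset_UNIV)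
  thus ?thesis
    using is_pole_inverse_iff[of f a] isolated_zero_analytic_iff[of f a] eventually_nonzero_at_entire[OF assms, of a]
    by (simp add: inverse_eq_divide)
qed

lemma zorder_reciprocal:
  assumes "f holomorphic_on UNIV" "f z0 \<noteq> 0"
  shows "zorder (\<lambda>z. 1 / f z) a = - zorder f a"
proof -
  have "f analytic_on {a}" using assms(1) by (metis analytic_on_open open_UNIV analytic_on_subset subset_UNIV)
  thus ?thesis
    using zorder_inverse[of f a] eventually_nonzero_at_entire[OF assms, of a]
    by (simp add: inverse_eq_divide isolated_singularity_at_analytic not_essential_analytic eventually_frequently)
qed

lemma pole_count_reciprocal:
  assumes f: "f holomorphic_on UNIV" "f z0 \<noteq> 0" and t: "t \<le> r"
  shows "real (pole_count (\<lambda>z. 1 / f z) t) =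
     (\<Sum>a | cmod a \<le> r \<and> f a = 0. real (nat (zorder f a)) * (if cmod a \<le> t then 1 else 0))"
proof -
  have "real (pole_count (\<lambda>z. 1 / f z) t) = (\<Sum>a | cmod a \<le> t \<and> f a = 0. real (nat (zorder f a)))"
    by (simp add: pole_count_def is_pole_reciprocal_iff[OF f] zorder_reciprocal[OF f])
  also have "\<dots> = (\<Sum>a | cmod a \<le> r \<and> f a = 0. real (nat (zorder f a)) * (if cmod a \<le> t then 1 else 0))"
    using t by (intro sum.mono_neutral_cong_left finite_zeros_cball[OF f]) auto
  finally show ?thesis .
qed

text \<open>
  A zero at \<open>a \<noteq> 0\<close> enters the counting function at \<open>t = |a|\<close>, and \<open>1/t\<close> integrates from \<open>|a|\<close> to \<open>r\<close> to
  \<open>ln (r / |a|)\<close>. This is the form in which the counting function occurs in Jensen's formula.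
\<close>

lemma nevanlinna_N_reciprocal:
  assumes f: "f holomorphic_on UNIV" "f z0 \<noteq> 0" and r: "r > 0"
  shows "nevanlinna_N r (\<lambda>z. 1 / f z) =
     (\<Sum>a | cmod a \<le> r \<and> f a = 0. nat (zorder f a) * (if a = 0 then ln r else ln (r / cmod a)))"
proof -
  define Z where "Z = {a. cmod a \<le> r \<and> f a = 0}"
  define m where "m = (\<lambda>a. real (nat (zorder f a)))"
  have finZ: "finite Z" unfolding Z_def by (rule finite_zeros_cball[OF f])
  have count: "real (pole_count (\<lambda>z. 1 / f z) t) = (\<Sum>a\<in>Z. m a * (if cmod a \<le> t then 1 else 0))" if "t \<le> r" for t
    using pole_count_reciprocal[OF f that] unfolding Z_def m_def .
  have single: "((\<lambda>t. m a * (if a \<noteq> 0 \<and> cmod a \<le> t then 1 / t else 0)) has_integral 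
      m a * (if a = 0 then 0 else ln (r / cmod a))) {0..r}" if "a \<in> Z" for a
  proof (cases "a = 0")
    case False
    hence a: "cmod a > 0" "cmod a \<le> r" using that by (auto simp: Z_def)
    have "((\<lambda>t. 1 / t) has_integral (ln r - ln (cmod a))) {cmod a..r}"
    proof (rule fundamental_theorem_of_calculus)
      fix t assume "t \<in> {cmod a..r}"
      hence "t > 0" using a(1) by (intro order.strict_trans2[OF a(1)]) auto
      thus "(ln has_vector_derivative 1 / t) (at t within {cmod a..r})"
        unfolding has_real_derivative_iff_has_vector_derivative[symmetric]
        by (auto intro!: derivative_eq_intros)
    qed (use a in auto)
    hence "((\<lambda>t. if t \<in> {cmod a..r} then 1 / t else 0) has_integral ln (r / cmod a)) {0..r}"
      using a r by (subst has_integral_restrict) (auto simp: ln_div)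
    hence "((\<lambda>t. if a \<noteq> 0 \<and> cmod a \<le> t then 1 / t else 0) has_integral ln (r / cmod a)) {0..r}"
      by (rule has_integral_eq[rotated]) (use False in auto)
    from has_integral_mult_right[OF this, of "m a"] False show ?thesis by simp
  qed auto
  have "((\<lambda>t. \<Sum>a\<in>Z. m a * (if a \<noteq> 0 \<and> cmod a \<le> t then 1 / t else 0)) has_integral
     (\<Sum>a\<in>Z. m a * (if a = 0 then 0 else ln (r / cmod a)))) {0..r}"
    by (intro has_integral_sum finZ single)
  hence "((\<lambda>t. (real (pole_count (\<lambda>z. 1 / f z) t) - real (pole_count (\<lambda>z. 1 / f z) 0)) / t) has_integral
     (\<Sum>a\<in>Z. m a * (if a = 0 then 0 else ln (r / cmod a)))) {0..r}"
  proof (rule has_integral_eq[rotated])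
    fix t assume t: "t \<in> {0..r}"
    show "(\<Sum>a\<in>Z. m a * (if a \<noteq> 0 \<and> cmod a \<le> t then 1 / t else 0)) =
      (real (pole_count (\<lambda>z. 1 / f z) t) - real (pole_count (\<lambda>z. 1 / f z) 0)) / t"
      using t r by (subst (1 2) count)
        (auto simp: sum_subtractf[symmetric] sum_divide_distrib intro!: sum.cong)
  qed
  hence "nevanlinna_N r (\<lambda>z. 1 / f z) =
      (\<Sum>a\<in>Z. m a * (if a = 0 then 0 else ln (r / cmod a))) + (\<Sum>a\<in>Z. m a * (if cmod a \<le> 0 then 1 else 0)) * ln r"
    unfolding nevanlinna_N_def using r count[of 0] by (simp add: integral_unique)
  also have "\<dots> = (\<Sum>a\<in>Z. m a * (if a = 0 then ln r else ln (r / cmod a)))"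
    by (auto simp: sum_distrib_right sum.distrib[symmetric] intro!: sum.cong)
  finally show ?thesis unfolding Z_def m_def .
qed

lemma nevanlinna_N_reciprocal_nonneg:
  assumes f: "f holomorphic_on UNIV" "f z0 \<noteq> 0" and r: "r \<ge> 1"
  shows "nevanlinna_N r (\<lambda>z. 1 / f z) \<ge> 0"
proof -
  have "0 \<le> (\<Sum>a | cmod a \<le> r \<and> f a = 0. nat (zorder f a) * (if a = 0 then ln r else ln (r / cmod a)))"
    using r by (intro sum_nonneg mult_nonneg_nonneg) auto
  thus ?thesis using nevanlinna_N_reciprocal[OF f, of r] r by simp
qed

section \<open>Holomorphic functions with bounded real part\<close>

text \<open>
  With \<open>q = g - g 0\<close> and \<open>N = M - Re (g 0)\<close>, the half-plane \<open>Re q < N\<close> is mapped into the unit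
  disc by \<open>q / (2 N - q)\<close>, which fixes \<open>0\<close>; the Schwarz lemma applies to the composite.
\<close>

lemma borel_caratheodory:
  fixes g :: "complex \<Rightarrow> complex"
  assumes g: "g holomorphic_on ball 0 \<rho>" and bound: "\<And>z. cmod z < \<rho> \<Longrightarrow> Re (g z) < M"
    and z: "cmod z < \<rho>"
  shows "cmod (g z - g 0) \<le> 2 * (M - Re (g 0)) * cmod z / (\<rho> - cmod z)"
proof -
  have \<rho>: "\<rho> > 0" using z norm_ge_zero[of z] by linarith
  define N where "N = M - Re (g 0)"
  have N: "N > 0" using bound[of 0] \<rho> by (simp add: N_def)
  define q where "q = (\<lambda>u. g (of_real \<rho> * u) - g 0)"
  define \<phi> where "\<phi> = (\<lambda>u. q u / (of_real (2 * N) - q u))"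
  have in_ball: "cmod (of_real \<rho> * u) < \<rho>" if "cmod u < 1" for u
    using that \<rho> by (simp add: norm_mult)
  have Re_q: "Re (q u) < N" if "cmod u < 1" for u
    using bound[OF in_ball[OF that]] by (simp add: q_def N_def)
  have den: "of_real (2 * N) - q u \<noteq> 0" if "cmod u < 1" for u
  proof
    assume "of_real (2 * N) - q u = 0"
    hence "Re (q u) = 2 * N" by (metis Re_complex_of_real eq_iff_diff_eq_0)
    thus False using Re_q[OF that] N by simp
  qed
  have q_hol: "q holomorphic_on ball 0 1"
  proof -
    have "(g \<circ> (\<lambda>u. of_real \<rho> * u)) holomorphic_on ball 0 1"
      by (rule holomorphic_on_compose_gen[OF _ g]) (use in_ball in \<open>auto intro!: holomorphic_intros\<close>)
    thus ?thesis unfolding q_def o_def by (intro holomorphic_intros)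
  qed
  have \<phi>_hol: "\<phi> holomorphic_on ball 0 1"
    unfolding \<phi>_def using den by (intro holomorphic_intros q_hol) auto
  have \<phi>_less: "cmod (\<phi> u) < 1" if "cmod u < 1" for u
  proof -
    have "(cmod (of_real (2 * N) - q u))\<^sup>2 - (cmod (q u))\<^sup>2 = 4 * N * (N - Re (q u))"
      unfolding cmod_power2 by (simp add: power2_eq_square algebra_simps)
    also have "\<dots> > 0" using N Re_q[OF that] by simp
    finally have "(cmod (q u))\<^sup>2 < (cmod (of_real (2 * N) - q u))\<^sup>2" by simp
    hence "cmod (q u) < cmod (of_real (2 * N) - q u)" by (rule power2_less_imp_less) simp
    moreover from this have "cmod (of_real (2 * N) - q u) > 0" using norm_ge_zero[of "q u"] by linarith
    ultimately show ?thesis unfolding \<phi>_def norm_divide by simp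
  qed
  define u where "u = z / of_real \<rho>"
  have u: "cmod u < 1" "of_real \<rho> * u = z" "cmod u = cmod z / \<rho>" using z \<rho> by (auto simp: u_def norm_divide)
  have \<phi>u: "cmod (\<phi> u) \<le> cmod u"
    by (rule Schwarz_Lemma(1)[OF \<phi>_hol _ \<phi>_less u(1)]) (simp_all add: \<phi>_def q_def)
  have "q u = \<phi> u * (of_real (2 * N) - q u)" using den[OF u(1)] by (simp add: \<phi>_def)
  hence "cmod (q u) = cmod (\<phi> u) * cmod (of_real (2 * N) - q u)" by (metis norm_mult)
  also have "\<dots> \<le> cmod u * (2 * N + cmod (q u))"
    using \<phi>u norm_triangle_ineq4[of "of_real (2 * N)" "q u"] N by (intro mult_mono) auto
  finally have "cmod (q u) * (1 - cmod u) \<le> 2 * N * cmod u" by (simp add: algebra_simps)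
  hence "cmod (q u) \<le> 2 * N * cmod u / (1 - cmod u)" using u(1) by (simp add: le_divide_eq)
  also have "\<dots> = 2 * N * cmod z / (\<rho> - cmod z)" using \<rho> z by (simp add: u(3) field_simps)
  finally show ?thesis by (simp add: q_def u(2) N_def)
qed

text \<open>
  Borel-Caratheodory bounds \<open>g - g 0\<close> by \<open>2 N\<close> on the disc of radius \<open>\<rho>/2\<close>, Cauchy's inequality
  then bounds the first two derivatives on the disc of radius \<open>\<rho>/4\<close>, and Taylor's theorem concludes. The point is the
  factor \<open>\<rho>\<^sup>-\<^sup>2\<close>: for \<open>N\<close> of size \<open>\<rho>\<close> and \<open>|z| \<le> \<rho>/T\<close> the error is of size \<open>\<rho> / T\<^sup>2\<close>,
  small compared with \<open>\<rho>/T\<close>.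
\<close>

lemma near_linear_of_bounded_real_part:
  fixes g :: "complex \<Rightarrow> complex"
  assumes g: "g holomorphic_on ball 0 \<rho>" and bound: "\<And>z. cmod z < \<rho> \<Longrightarrow> Re (g z) < M" and \<rho>: "\<rho> > 0"
  defines "N \<equiv> M - Re (g 0)"
  shows "cmod (deriv g 0) \<le> 8 * N / \<rho>"
    and "cmod z \<le> \<rho> / 4 \<Longrightarrow> cmod (g z - (g 0 + deriv g 0 * z)) \<le> 64 * N / \<rho>\<^sup>2 * (cmod z)\<^sup>2"
proof -
  define G where "G = (\<lambda>u. g u - g 0)"
  have N: "N > 0" using bound[of 0] \<rho> by (simp add: N_def)
  have G_hol: "G holomorphic_on ball 0 \<rho>" unfolding G_def by (intro holomorphic_intros g)
  have G_bound: "cmod (G u) \<le> 2 * N" if u: "cmod u \<le> \<rho> / 2" for u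
  proof -
    have "cmod (G u) \<le> 2 * N * cmod u / (\<rho> - cmod u)"
      unfolding G_def N_def by (rule borel_caratheodory[OF g bound]) (use u \<rho> in auto)
    also have "\<dots> \<le> 2 * N"
      using u \<rho> N by (subst divide_le_eq) (auto intro!: mult_left_mono)
    finally show ?thesis .
  qed
  have cauchy: "cmod ((deriv ^^ k) G x) \<le> fact k * (2 * N) / (\<rho> / 4) ^ k" if x: "cmod x \<le> \<rho> / 4" for k x
  proof (rule Cauchy_inequality)
    have sub: "cball x (\<rho> / 4) \<subseteq> cball 0 (\<rho> / 2)"
    proof
      fix y assume "y \<in> cball x (\<rho> / 4)"
      thus "y \<in> cball 0 (\<rho> / 2)" using norm_triangle_ineq2[of y x] x by (auto simp: dist_norm norm_minus_commute)
    qed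
    have sub': "cball 0 (\<rho> / 2) \<subseteq> ball (0::complex) \<rho>" using \<rho> by auto
    show "G holomorphic_on ball x (\<rho> / 4)"
      using G_hol by (rule holomorphic_on_subset) (use sub sub' ball_subset_cball in blast)
    show "continuous_on (cball x (\<rho> / 4)) G"
      using holomorphic_on_imp_continuous_on[OF G_hol] by (rule continuous_on_subset) (use sub sub' in blast)
    fix y assume "cmod (x - y) = \<rho> / 4"
    hence "y \<in> cball 0 (\<rho> / 2)" using sub by (auto simp: dist_norm)
    thus "cmod (G y) \<le> 2 * N" using G_bound[of y] by auto
  qed (use \<rho> in auto)
  have G': "deriv G 0 = deriv g 0"
  proof -
    have "(g has_field_derivative deriv g 0) (at 0)"
      using holomorphic_derivI[OF g open_ball, of 0] \<rho> by simp
    hence "(G has_field_derivative deriv g 0) (at 0)" unfolding G_def by (auto intro!: derivative_eq_intros)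
    thus ?thesis by (rule DERIV_imp_deriv)
  qed
  show "cmod (deriv g 0) \<le> 8 * N / \<rho>"
    using cauchy[of 0 1] \<rho> G' by simp
  assume z: "cmod z \<le> \<rho> / 4"
  have "cmod ((deriv ^^ 0) G z - (\<Sum>i\<le>1. (deriv ^^ i) G 0 * (z - 0) ^ i / fact i)) \<le> 64 * N / \<rho>\<^sup>2 * cmod (z - 0) ^ Suc 1 / fact 1"
  proof (rule complex_Taylor[of "cball 0 (\<rho> / 4)"])
    fix i and x :: complex assume "x \<in> cball 0 (\<rho> / 4)"
    hence "x \<in> ball 0 \<rho>" using \<rho> by auto
    from has_field_derivative_higher_deriv[OF G_hol open_ball this, of i]
    show "((deriv ^^ i) G has_field_derivative (deriv ^^ Suc i) G x) (at x within cball 0 (\<rho> / 4))"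
      by (rule has_field_derivative_at_within)
  next
    fix x :: complex assume "x \<in> cball 0 (\<rho> / 4)"
    hence "cmod ((deriv ^^ Suc 1) G x) \<le> fact 2 * (2 * N) / (\<rho> / 4) ^ 2"
      using cauchy[of x 2] by (simp add: numeral_2_eq_2)
    thus "cmod ((deriv ^^ Suc 1) G x) \<le> 64 * N / \<rho>\<^sup>2" by (simp add: power_divide)
  qed (use z \<rho> in auto)
  thus "cmod (g z - (g 0 + deriv g 0 * z)) \<le> 64 * N / \<rho>\<^sup>2 * (cmod z)\<^sup>2"
    using G' by (simp add: G_def numeral_2_eq_2 algebra_simps)
qed

section \<open>Few zeros force nearly exponential behaviour\<close>

lemma proximity_le_of_exponential_type:
  assumes f: "f holomorphic_on UNIV" and A: "A \<ge> 0" and type: "\<And>z. cmod (f z) \<le> exp (A * (1 + cmod z))"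
    and r: "r \<ge> 0"
  shows "proximity_m r f \<le> A * (1 + r)"
proof -
  have "integral {0..2*pi} (\<lambda>t. log_plus (cmod (f (of_real r * cis t)))) \<le> integral {0..2*pi} (\<lambda>t. A * (1 + r))"
  proof (rule integral_le[OF log_plus_circle_integrable[OF f]])
    fix t :: real
    have "max 1 (cmod (f (of_real r * cis t))) \<le> exp (A * (1 + r))"
      using type[of "of_real r * cis t"] A r by (simp add: norm_mult)
    hence "ln (max 1 (cmod (f (of_real r * cis t)))) \<le> ln (exp (A * (1 + r)))"
      by (intro ln_mono) auto
    thus "log_plus (cmod (f (of_real r * cis t))) \<le> A * (1 + r)" by (simp add: log_plus_def)
  qed auto
  also have "\<dots> = 2 * pi * (A * (1 + r))" by simp
  finally show ?thesis unfolding proximity_m_def by (simp add: field_simps)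
qed

text \<open>
  The exceptional set has finite measure and the moduli of the zeros are countable, so together they
  cannot cover a long interval. Outside them the counting function is \<open>o(m(r))\<close>, and \<open>m(r) = O(r)\<close>.
\<close>

lemma good_radius_exists:
  fixes f :: "complex \<Rightarrow> complex"
  assumes f: "f holomorphic_on UNIV" "f z0 \<noteq> 0" and A: "A \<ge> 0" and type: "\<And>z. cmod (f z) \<le> exp (A * (1 + cmod z))"
    and few: "small_growth (\<lambda>r. nevanlinna_N r (\<lambda>z. 1 / f z)) f" and \<delta>: "\<delta> > 0"
  obtains \<rho> where "\<rho> \<ge> r1" "nevanlinna_N \<rho> (\<lambda>z. 1 / f z) \<le> \<delta> * \<rho>" "\<And>z. cmod z = \<rho> \<Longrightarrow> f z \<noteq> 0"
proof -
  \<comment> \<open>Chosen so that \<open>\<kappa> A (1 + \<rho>) \<le> \<delta> \<rho>\<close> for \<open>\<rho> \<ge> 1\<close>.\<close>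
  define \<kappa> where "\<kappa> = \<delta> / (2 * A + 1)"
  have \<kappa>: "\<kappa> > 0" using \<delta> A by (simp add: \<kappa>_def)
  obtain E where E: "E \<in> lmeasurable"
    and o: "(\<lambda>r. nevanlinna_N r (\<lambda>z. 1 / f z)) \<in> o[inf at_top (principal (- E))](\<lambda>r. nevanlinna_T r f)"
    using few unfolding small_growth_def by blast
  from landau_o.smallD[OF o \<kappa>]
  have "\<forall>\<^sub>F r in at_top. r \<in> - E \<longrightarrow> \<bar>nevanlinna_N r (\<lambda>z. 1 / f z)\<bar> \<le> \<kappa> * \<bar>proximity_m r f\<bar>"
    unfolding eventually_inf_principal by (simp add: nevanlinna_T_entire[OF f(1)])
  then obtain r2 where r2: "\<And>r. r \<ge> r2 \<Longrightarrow> r \<notin> E \<Longrightarrow> \<bar>nevanlinna_N r (\<lambda>z. 1 / f z)\<bar> \<le> \<kappa> * proximity_m r f"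
    unfolding eventually_at_top_linorder by (auto simp: proximity_nonneg)
  define s where "s = max 1 (max r1 r2)"
  define Z where "Z = cmod ` {z. f z = 0}"
  have "countable {z. f z = 0}"
  proof -
    have "{z. f z = 0} = (\<Union>n::nat. {z. cmod z \<le> real n \<and> f z = 0})"
      using real_arch_simple by auto
    also have "countable \<dots>" by (rule countable_UN) (auto intro: countable_finite finite_zeros_cball[OF f])
    finally show ?thesis .
  qed
  hence "Z \<in> null_sets lborel" unfolding Z_def by (intro countable_imp_null_set_lborel countable_image)
  hence Zm: "Z \<in> lmeasurable" by (intro negligible_imp_measurable) (simp add: negligible_iff_null_sets null_sets_completionI)
  define L where "L = measure lebesgue (E \<union> Z) + 1"
  have L: "L > 0" unfolding L_def by (simp add: add_nonneg_pos)
  have "\<not> {s..s + L} \<subseteq> E \<union> Z"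
  proof
    assume "{s..s + L} \<subseteq> E \<union> Z"
    hence "measure lebesgue {s..s + L} \<le> measure lebesgue (E \<union> Z)"
      using E Zm by (intro measure_mono_fmeasurable fmeasurable.Un) auto
    thus False using L by (simp add: L_def)
  qed
  then obtain \<rho> where "\<rho> \<in> {s..s + L}" "\<rho> \<notin> E \<union> Z" by blast
  hence \<rho>: "s \<le> \<rho>" "\<rho> \<notin> E" "\<rho> \<notin> Z" by auto
  show ?thesis
  proof
    show "\<rho> \<ge> r1" using \<rho>(1) by (simp add: s_def)
    show "f z \<noteq> 0" if "cmod z = \<rho>" for z using \<rho>(3) that by (auto simp: Z_def)
    have \<rho>1: "\<rho> \<ge> 1" "\<rho> \<ge> r2" using \<rho>(1) by (auto simp: s_def)
    have "nevanlinna_N \<rho> (\<lambda>z. 1 / f z) \<le> \<kappa> * proximity_m \<rho> f" using r2[OF \<rho>1(2) \<rho>(2)] by simp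
    also have "\<dots> \<le> \<kappa> * (A * (1 + \<rho>))"
      using proximity_le_of_exponential_type[OF f(1) A type] \<rho>1 \<kappa> by (intro mult_left_mono) auto
    also have "\<dots> \<le> \<kappa> * ((2 * A + 1) * \<rho>)"
    proof (rule mult_left_mono)
      have "A * 1 \<le> A * \<rho>" using A \<rho>1(1) by (intro mult_left_mono) auto
      thus "A * (1 + \<rho>) \<le> (2 * A + 1) * \<rho>" using \<rho>1(1) by (simp add: algebra_simps)
    qed (use \<kappa> in auto)
    also have "\<dots> = \<delta> * \<rho>" using A by (simp add: \<kappa>_def)
    finally show "nevanlinna_N \<rho> (\<lambda>z. 1 / f z) \<le> \<delta> * \<rho>" .
  qed
qed

text \<open>
  Take the logarithmic majorant \<open>g\<close> on a good radius \<open>\<rho> = T R\<close>. The constant term of \<open>g\<close> is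
  \<open>O(1) + N(\<rho>, 1/f)\<close>, hence small compared with \<open>R\<close>, and the deviation from linearity is \<open>O(R / T)\<close>.
  The slope bound is independent of \<open>\<epsilon>\<close>, which the compactness argument in
  \<open>subexponential_after_exponential_factor\<close> relies on.
\<close>

lemma exponential_majorant_at_some_scale:
  fixes f :: "complex \<Rightarrow> complex"
  assumes f: "f holomorphic_on UNIV" "f z0 \<noteq> 0" and A: "A \<ge> 0" and type: "\<And>z. cmod (f z) \<le> exp (A * (1 + cmod z))"
    and few: "small_growth (\<lambda>r. nevanlinna_N r (\<lambda>z. 1 / f z)) f" and \<epsilon>: "\<epsilon> > 0"
  obtains R a where "R \<ge> R0" "cmod a \<le> 8 * (A + 1)" "\<And>z. cmod z \<le> R \<Longrightarrow> cmod (f z) \<le> exp (Re (a * z) + \<epsilon> * R)"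
proof -
  define c0 where "c0 = ln (cmod (zor_poly f 0 0))"
  \<comment> \<open>The Taylor error \<open>64 (A + 1) R / T\<close>, the zeros \<open>\<delta> T R\<close> and the constant \<open>|c0|\<close> each use up at most a third of \<open>\<epsilon> R\<close>.\<close>
  define T where "T = max 4 (192 * (A + 1) / \<epsilon>)"
  have T: "T \<ge> 4" "192 * (A + 1) \<le> T * \<epsilon>" using \<epsilon> by (auto simp: T_def field_simps max_def)
  define \<delta> where "\<delta> = \<epsilon> / (3 * T)"
  have \<delta>: "\<delta> > 0" using \<epsilon> T by (simp add: \<delta>_def)
  define r1 where "r1 = max (max 1 (T * R0)) (max (A + 2 * \<bar>c0\<bar> + 1) (T * (3 * \<bar>c0\<bar> / \<epsilon>)))"
  obtain \<rho> where \<rho>: "\<rho> \<ge> r1" "nevanlinna_N \<rho> (\<lambda>z. 1 / f z) \<le> \<delta> * \<rho>" "\<And>z. cmod z = \<rho> \<Longrightarrow> f z \<noteq> 0"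
    using good_radius_exists[OF f A type few \<delta>, of r1] by blast
  have \<rho>_ge: "\<rho> \<ge> 1" "\<rho> \<ge> T * R0" "\<rho> \<ge> A + 2 * \<bar>c0\<bar> + 1" "\<rho> \<ge> T * (3 * \<bar>c0\<bar> / \<epsilon>)"
    using \<rho>(1) unfolding r1_def by auto
  have \<rho>0: "\<rho> > 0" using \<rho>_ge by simp
  obtain g \<rho>' where g: "\<rho> < \<rho>'" "g holomorphic_on ball 0 \<rho>'"
    "\<And>z. cmod z \<le> \<rho> \<Longrightarrow> cmod (f z) \<le> exp (Re (g z))"
    "\<And>z. cmod z = \<rho> \<Longrightarrow> cmod (f z) = exp (Re (g z))"
    and g0: "Re (g 0) = c0 + nevanlinna_N \<rho> (\<lambda>z. 1 / f z)"
    unfolding nevanlinna_N_reciprocal[OF f \<rho>0] c0_def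
    by (rule entire_logarithmic_majorant[OF f \<rho>0 \<rho>(3)]) blast+
  \<comment> \<open>The surplus \<open>1\<close> makes the bound on \<open>Re (g z)\<close> strict.\<close>
  define M where "M = A * (1 + \<rho>) + \<bar>c0\<bar> + 1"
  have Re_g: "Re (g z) < M" if "cmod z < \<rho>" for z
  proof -
    have "Re (g z) \<le> A * (1 + \<rho>)"
    proof (rule maximum_real_frontier[of g "cball 0 \<rho>"])
      show "g holomorphic_on interior (cball 0 \<rho>)" using g(2) by (rule holomorphic_on_subset) (use g(1) in auto)
      show "continuous_on (closure (cball 0 \<rho>)) g"
        using holomorphic_on_imp_continuous_on[OF g(2)] by (rule continuous_on_subset) (use g(1) in auto)
      fix u :: complex assume "u \<in> frontier (cball 0 \<rho>)"
      hence u: "cmod u = \<rho>" using \<rho>0 by auto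
      hence "exp (Re (g u)) \<le> exp (A * (1 + \<rho>))" using g(4)[OF u] type[of u] by simp
      thus "Re (g u) \<le> A * (1 + \<rho>)" by simp
    qed (use that in auto)
    thus ?thesis by (simp add: M_def)
  qed
  define N where "N = M - Re (g 0)"
  have N0: "N > 0" using Re_g[of 0] \<rho>0 by (simp add: N_def)
  define a where "a = deriv g 0"
  have Nle: "N \<le> (A + 1) * \<rho>"
  proof -
    have "N \<le> A * (1 + \<rho>) + 2 * \<bar>c0\<bar> + 1"
      using nevanlinna_N_reciprocal_nonneg[OF f \<rho>_ge(1)] unfolding N_def M_def g0 by linarith
    thus ?thesis using \<rho>_ge(3) by (simp add: algebra_simps)
  qed
  have g_ball: "g holomorphic_on ball 0 \<rho>" using g(2) by (rule holomorphic_on_subset) (use g(1) in auto)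
  note near = near_linear_of_bounded_real_part[OF g_ball Re_g \<rho>0, folded N_def a_def]
  define R where "R = \<rho> / T"
  have R: "R > 0" "\<rho> = T * R" using \<rho>0 T by (simp_all add: R_def)
  show ?thesis
  proof
    show "R \<ge> R0" using \<rho>_ge(2) T unfolding R(2) by simp
    have "8 * N / \<rho> \<le> 8 * ((A + 1) * \<rho>) / \<rho>" using Nle \<rho>0 by (intro divide_right_mono mult_left_mono) auto
    thus "cmod a \<le> 8 * (A + 1)" using near(1) \<rho>0 by simp
    fix z assume z: "cmod z \<le> R"
    have "4 * R \<le> T * R" using T R by (intro mult_right_mono) auto
    hence z4: "cmod z \<le> \<rho> / 4" and z\<rho>: "cmod z \<le> \<rho>" using z R(1) unfolding R(2) by linarith+
    have "Re (g z) = Re (g 0) + Re (a * z) + Re (g z - (g 0 + a * z))" by simp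
    also have "Re (g z - (g 0 + a * z)) \<le> 64 * N / \<rho>\<^sup>2 * (cmod z)\<^sup>2"
      using near(2)[OF _ z4] complex_Re_le_cmod order_trans by blast
    also have "\<dots> \<le> 64 * ((A + 1) * \<rho>) / \<rho>\<^sup>2 * R\<^sup>2"
      using Nle z A \<rho>0 N0 by (intro mult_mono divide_right_mono power_mono) auto
    also have "\<dots> = 64 * (A + 1) * R / T" using R T by (simp add: power2_eq_square field_simps)
    also have "\<dots> \<le> \<epsilon> * R / 3"
    proof -
      have "192 * (A + 1) * R \<le> T * \<epsilon> * R" using T(2) R by (intro mult_right_mono) auto
      thus ?thesis using T(1) by (simp add: field_simps)
    qed
    also have "Re (g 0) \<le> \<epsilon> * R / 3 + \<epsilon> * R / 3"
    proof -
      have "\<delta> * \<rho> = \<epsilon> * R / 3" using T(1) by (simp add: \<delta>_def R(2))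
      moreover have "3 * \<bar>c0\<bar> / \<epsilon> \<le> R"
        by (rule mult_left_le_imp_le[of T]) (use \<rho>_ge(4) T(1) R(2) in linarith)+
      hence "\<bar>c0\<bar> \<le> \<epsilon> * R / 3" using \<epsilon> by (simp add: field_simps)
      ultimately show ?thesis using \<rho>(2) unfolding g0 by linarith
    qed
    finally have "Re (g z) \<le> Re (a * z) + \<epsilon> * R" by (simp add: algebra_simps)
    thus "cmod (f z) \<le> exp (Re (a * z) + \<epsilon> * R)" using g(3)[OF z\<rho>] by (meson exp_le_cancel_iff order_trans)
  qed
qed

section \<open>Subexponential growth along a sequence of radii\<close>

text \<open>
  A weak form of "minimal exponential type", required only on the discs of radii \<open>R m\<close>. Enlarging
  the discs by an arbitrary constant \<open>B\<close> makes the class closed under translation and differentiation.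
\<close>

definition subexponential_along :: "(nat \<Rightarrow> real) \<Rightarrow> (complex \<Rightarrow> complex) \<Rightarrow> bool" where
  "subexponential_along R P \<longleftrightarrow>
     (\<forall>\<epsilon>>0. \<forall>B. \<forall>\<^sub>F m in sequentially. \<forall>z. cmod z \<le> R m + B \<longrightarrow> cmod (P z) \<le> exp (\<epsilon> * R m))"

lemma subexponential_alongD:
  "subexponential_along R P \<Longrightarrow> \<epsilon> > 0 \<Longrightarrow>
     \<forall>\<^sub>F m in sequentially. \<forall>z. cmod z \<le> R m + B \<longrightarrow> cmod (P z) \<le> exp (\<epsilon> * R m)"
  unfolding subexponential_along_def by blast

lemma eventually_const_le_exp:
  fixes R :: "nat \<Rightarrow> real"
  assumes "filterlim R at_top sequentially" "\<epsilon> > 0"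
  shows "\<forall>\<^sub>F m in sequentially. x \<le> exp (\<epsilon> * R m)"
proof -
  have "filterlim (\<lambda>m. \<epsilon> * R m) at_top sequentially"
    using filterlim_tendsto_pos_mult_at_top[of "\<lambda>_. \<epsilon>" \<epsilon> sequentially R] assms by simp
  hence "filterlim (\<lambda>m. exp (\<epsilon> * R m)) at_top sequentially"
    by (rule filterlim_compose[OF exp_at_top])
  thus ?thesis by (simp add: filterlim_at_top)
qed

lemma subexponential_along_const:
  assumes "filterlim R at_top sequentially"
  shows "subexponential_along R (\<lambda>_. x)"
  unfolding subexponential_along_def
proof (intro allI impI)
  fix \<epsilon> B :: real assume "\<epsilon> > 0"
  from eventually_const_le_exp[OF assms this, of "cmod x"]
  show "\<forall>\<^sub>F m in sequentially. \<forall>z. cmod z \<le> R m + B \<longrightarrow> cmod x \<le> exp (\<epsilon> * R m)"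
    by eventually_elim blast
qed

lemma subexponential_along_mult:
  assumes "subexponential_along R P" "subexponential_along R Q"
  shows "subexponential_along R (\<lambda>z. P z * Q z)"
  unfolding subexponential_along_def
proof (intro allI impI)
  fix \<epsilon> B :: real assume "\<epsilon> > 0"
  hence "\<epsilon> / 2 > 0" by simp
  from subexponential_alongD[OF assms(1) this, of B] subexponential_alongD[OF assms(2) this, of B]
  show "\<forall>\<^sub>F m in sequentially. \<forall>z. cmod z \<le> R m + B \<longrightarrow> cmod (P z * Q z) \<le> exp (\<epsilon> * R m)"
  proof eventually_elim
    case (elim m)
    show ?case
    proof (intro allI impI)
      fix z assume z: "cmod z \<le> R m + B"
      have "cmod (P z * Q z) \<le> exp (\<epsilon> / 2 * R m) * exp (\<epsilon> / 2 * R m)"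
        unfolding norm_mult using elim z by (intro mult_mono) auto
      thus "cmod (P z * Q z) \<le> exp (\<epsilon> * R m)" by (simp flip: exp_add)
    qed
  qed
qed

lemma subexponential_along_add:
  assumes R: "filterlim R at_top sequentially"
    and "subexponential_along R P" "subexponential_along R Q"
  shows "subexponential_along R (\<lambda>z. P z + Q z)"
  unfolding subexponential_along_def
proof (intro allI impI)
  fix \<epsilon> B :: real assume "\<epsilon> > 0"
  hence e: "\<epsilon> / 2 > 0" by simp
  from subexponential_alongD[OF assms(2) e, of B] subexponential_alongD[OF assms(3) e, of B]
    eventually_const_le_exp[OF R e, of 2]
  show "\<forall>\<^sub>F m in sequentially. \<forall>z. cmod z \<le> R m + B \<longrightarrow> cmod (P z + Q z) \<le> exp (\<epsilon> * R m)"
  proof eventually_elim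
    case (elim m)
    show ?case
    proof (intro allI impI)
      fix z assume z: "cmod z \<le> R m + B"
      have "cmod (P z + Q z) \<le> exp (\<epsilon> / 2 * R m) + exp (\<epsilon> / 2 * R m)"
        using elim z by (intro norm_triangle_mono) auto
      also have "\<dots> = 2 * exp (\<epsilon> / 2 * R m)" by simp
      also have "\<dots> \<le> exp (\<epsilon> / 2 * R m) * exp (\<epsilon> / 2 * R m)"
        using elim(3) by (intro mult_right_mono) auto
      finally show "cmod (P z + Q z) \<le> exp (\<epsilon> * R m)" by (simp flip: exp_add)
    qed
  qed
qed

lemma subexponential_along_power:
  assumes "filterlim R at_top sequentially" "subexponential_along R P"
  shows "subexponential_along R (\<lambda>z. P z ^ n)"
  by (induction n) (auto intro: subexponential_along_mult subexponential_along_const assms)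

text \<open>
  Cauchy's inequality on the unit circle around \<open>z + c\<close>: there \<open>exp (a u)\<close> differs from \<open>exp (a z)\<close> by a
  bounded factor, which the exponential slack absorbs.
\<close>

lemma subexponential_along_higher_deriv_shift:
  fixes f :: "complex \<Rightarrow> complex"
  assumes R: "filterlim R at_top sequentially" and f: "f holomorphic_on UNIV"
    and sub: "subexponential_along R (\<lambda>z. f z * exp (- a * z))"
  shows "subexponential_along R (\<lambda>z. (deriv ^^ k) f (z + c) * exp (- a * z))"
  unfolding subexponential_along_def
proof (intro allI impI)
  fix \<epsilon> B :: real assume "\<epsilon> > 0"
  hence e: "\<epsilon> / 2 > 0" by simp
  define K where "K = fact k * exp (cmod a * (cmod c + 1))"
  from subexponential_alongD[OF sub e, of "B + cmod c + 1"] eventually_const_le_exp[OF R e, of K]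
  show "\<forall>\<^sub>F m in sequentially. \<forall>z. cmod z \<le> R m + B \<longrightarrow> cmod ((deriv ^^ k) f (z + c) * exp (- a * z)) \<le> exp (\<epsilon> * R m)"
  proof eventually_elim
    case (elim m)
    show ?case
    proof (intro allI impI)
      fix z assume z: "cmod z \<le> R m + B"
      define X where "X = exp (\<epsilon> / 2 * R m) * exp (Re (a * z) + cmod a * (cmod c + 1))"
      have "cmod ((deriv ^^ k) f (z + c)) \<le> fact k * X / 1 ^ k"
      proof (rule Cauchy_inequality)
        show "f holomorphic_on ball (z + c) 1" using f by (rule holomorphic_on_subset) auto
        show "continuous_on (cball (z + c) 1) f"
          using holomorphic_on_imp_continuous_on[OF f] by (rule continuous_on_subset) auto
        fix u assume u: "cmod (z + c - u) = 1"
        have "cmod (u - z) \<le> cmod (z + c - u) + cmod c"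
          using norm_triangle_ineq4[of c "z + c - u"] by (simp add: algebra_simps)
        hence uz: "cmod (u - z) \<le> cmod c + 1" using u by simp
        have "cmod u \<le> R m + (B + cmod c + 1)" using norm_triangle_ineq2[of u z] uz z by linarith
        hence "cmod (f u * exp (- a * u)) \<le> exp (\<epsilon> / 2 * R m)" using elim(1) by blast
        hence "cmod (f u) * exp (- Re (a * u)) \<le> exp (\<epsilon> / 2 * R m)" by (simp add: norm_mult)
        hence "cmod (f u) \<le> exp (\<epsilon> / 2 * R m) * exp (Re (a * u))" by (simp only: exp_minus) (simp add: field_simps)
        also have "\<dots> \<le> X"
        proof -
          have "Re (a * u) = Re (a * z) + Re (a * (u - z))" by (simp add: algebra_simps)
          also have "Re (a * (u - z)) \<le> cmod (a * (u - z))" by (rule complex_Re_le_cmod)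
          also have "\<dots> \<le> cmod a * (cmod c + 1)" unfolding norm_mult using uz by (intro mult_left_mono) auto
          finally show ?thesis unfolding X_def by simp
        qed
        finally show "cmod (f u) \<le> X" .
      qed auto
      hence "cmod ((deriv ^^ k) f (z + c) * exp (- a * z)) \<le> fact k * X * exp (- Re (a * z))"
        by (simp add: norm_mult)
      also have "\<dots> = K * exp (\<epsilon> / 2 * R m)"
        unfolding X_def K_def exp_add exp_minus by simp
      also have "\<dots> \<le> exp (\<epsilon> / 2 * R m) * exp (\<epsilon> / 2 * R m)"
        using elim(2) by (intro mult_right_mono) auto
      finally show "cmod ((deriv ^^ k) f (z + c) * exp (- a * z)) \<le> exp (\<epsilon> * R m)" by (simp flip: exp_add)
    qed
  qed
qed

text \<open>
  Choose scales tending to infinity with error \<open>\<epsilon> = 1 / (m + 1)\<close>, and a subsequence along which the slopes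
  converge to \<open>a\<close>; replacing the slope by its limit costs a factor \<open>exp (o(1) R)\<close>.
\<close>

lemma subexponential_after_exponential_factor:
  fixes f :: "complex \<Rightarrow> complex"
  assumes f: "f holomorphic_on UNIV" "f z0 \<noteq> 0" and A: "A \<ge> 0" and type: "\<And>z. cmod (f z) \<le> exp (A * (1 + cmod z))"
    and few: "small_growth (\<lambda>r. nevanlinna_N r (\<lambda>z. 1 / f z)) f"
  obtains R :: "nat \<Rightarrow> real" and a where "filterlim R at_top sequentially"
    "subexponential_along R (\<lambda>z. f z * exp (- a * z))"
proof -
  have "\<exists>R a. R \<ge> real m \<and> cmod a \<le> 8 * (A + 1) \<and> (\<forall>z. cmod z \<le> R \<longrightarrow> cmod (f z) \<le> exp (Re (a * z) + 1 / (real m + 1) * R))" for m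
    using exponential_majorant_at_some_scale[OF f A type few, of "1 / (real m + 1)" "real m"] by (metis divide_pos_pos of_nat_0_le_iff add_nonneg_pos zero_less_one)
  then obtain \<rho> b where \<rho>: "\<And>m. \<rho> m \<ge> real m" and b: "\<And>m. cmod (b m) \<le> 8 * (A + 1)"
    and le: "\<And>m z. cmod z \<le> \<rho> m \<Longrightarrow> cmod (f z) \<le> exp (Re (b m * z) + 1 / (real m + 1) * \<rho> m)"
    by metis
  have "seq_compact (cball (0::complex) (8 * (A + 1)))" using compact_cball compact_imp_seq_compact by blast
  then obtain a s where a: "strict_mono s" "(b \<circ> s) \<longlonglongrightarrow> a"
    using b unfolding seq_compact_def by (metis dist_0_norm mem_cball)
  \<comment> \<open>Halving the radii leaves room for the enlargement of the discs by \<open>B\<close>.\<close>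
  define R where "R = (\<lambda>m. \<rho> (s m) / 2)"
  have Rge: "R m \<ge> real m / 2" for m
    using \<rho>[of "s m"] seq_suble[OF a(1), of m] unfolding R_def by simp
  have Rtop: "filterlim R at_top sequentially"
  proof (rule filterlim_at_top_mono)
    show "filterlim (\<lambda>m. real m / 2) at_top sequentially" by real_asymp
    show "\<forall>\<^sub>F m in sequentially. real m / 2 \<le> R m" using Rge by simp
  qed
  show ?thesis
  proof (rule that[OF Rtop])
    show "subexponential_along R (\<lambda>z. f z * exp (- a * z))"
      unfolding subexponential_along_def
    proof (intro allI impI)
      fix \<epsilon> B :: real assume \<epsilon>: "\<epsilon> > 0"
      have "(\<lambda>m. (cmod (b (s m) - a) + 1 / (real (s m) + 1)) * 2) \<longlonglongrightarrow> (cmod (a - a) + 0) * 2"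
      proof (intro tendsto_intros)
        show "(\<lambda>m. b (s m)) \<longlonglongrightarrow> a" using a(2) by (simp add: o_def)
        have "(\<lambda>m. 1 / (real m + 1)) \<longlonglongrightarrow> 0" by real_asymp
        thus "(\<lambda>m. 1 / (real (s m) + 1)) \<longlonglongrightarrow> 0"
          using LIMSEQ_subseq_LIMSEQ[OF _ a(1), of "\<lambda>m. 1 / (real m + 1)"] by (simp add: o_def)
      qed
      hence ev1: "\<forall>\<^sub>F m in sequentially. (cmod (b (s m) - a) + 1 / (real (s m) + 1)) * 2 < \<epsilon>"
        by (rule order_tendstoD) (use \<epsilon> in auto)
      have ev2: "\<forall>\<^sub>F m in sequentially. R m \<ge> max B 0" using Rtop unfolding filterlim_at_top by blast
      from ev1 ev2 show "\<forall>\<^sub>F m in sequentially. \<forall>z. cmod z \<le> R m + B \<longrightarrow> cmod (f z * exp (- a * z)) \<le> exp (\<epsilon> * R m)"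
      proof eventually_elim
        case (elim m)
        show ?case
        proof (intro allI impI)
          fix z assume "cmod z \<le> R m + B"
          hence z: "cmod z \<le> 2 * R m" using elim(2) by simp
          have "cmod (f z) \<le> exp (Re (b (s m) * z) + 1 / (real (s m) + 1) * (2 * R m))"
            using le[of z "s m"] z by (simp add: R_def)
          hence "cmod (f z * exp (- a * z)) \<le> exp (Re (b (s m) * z) + 1 / (real (s m) + 1) * (2 * R m)) * exp (- Re (a * z))"
            by (simp add: norm_mult)
          also have "\<dots> = exp (Re ((b (s m) - a) * z) + 1 / (real (s m) + 1) * (2 * R m))"
            unfolding exp_add[symmetric] by (simp add: algebra_simps)
          also have "\<dots> \<le> exp (\<epsilon> * R m)"
          proof -
            have "Re ((b (s m) - a) * z) \<le> cmod (b (s m) - a) * cmod z"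
              using complex_Re_le_cmod[of "(b (s m) - a) * z"] by (simp only: norm_mult)
            also have "\<dots> \<le> cmod (b (s m) - a) * (2 * R m)" using z by (intro mult_left_mono) auto
            finally have "Re ((b (s m) - a) * z) + 1 / (real (s m) + 1) * (2 * R m)
               \<le> (cmod (b (s m) - a) + 1 / (real (s m) + 1)) * 2 * R m" by (simp add: algebra_simps)
            also have "\<dots> \<le> \<epsilon> * R m" using elim by (intro mult_right_mono) auto
            finally show ?thesis by simp
          qed
          finally show "cmod (f z * exp (- a * z)) \<le> exp (\<epsilon> * R m)" .
        qed
      qed
    qed
  qed
qed

text \<open>
  A logarithm \<open>q\<close> of \<open>h\<close> has \<open>Re q \<le> \<epsilon> (R m)\<close> on the disc of radius \<open>R m\<close>. Borel-Caratheodory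
  then bounds \<open>q z - q 0\<close> by a multiple of \<open>\<epsilon> |z|\<close>, uniformly in \<open>m\<close>.
\<close>

lemma nonvanishing_subexponential_constant:
  fixes h :: "complex \<Rightarrow> complex"
  assumes R: "filterlim R at_top sequentially" and h: "h holomorphic_on UNIV" "\<And>z. h z \<noteq> 0"
    and sub: "subexponential_along R h"
  shows "h z = h 0"
proof -
  obtain q where q: "q holomorphic_on UNIV" "\<And>z. exp (q z) = h z"
    using holomorphic_logarithm_exists[OF convex_UNIV open_UNIV h(1), of 0] h(2) by auto
  have "cmod (q z - q 0) \<le> e" if e: "e > 0" for e
  proof -
    define \<epsilon> where "\<epsilon> = e / (8 * cmod z + 1)"
    have \<epsilon>: "\<epsilon> > 0" unfolding \<epsilon>_def using e by (intro divide_pos_pos) (auto intro: add_nonneg_pos)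
    have "\<forall>\<^sub>F m in sequentially. \<forall>u. cmod u \<le> R m + 0 \<longrightarrow> cmod (h u) \<le> exp (\<epsilon> * R m)"
      by (rule subexponential_alongD[OF sub \<epsilon>])
    moreover have "\<forall>\<^sub>F m in sequentially. R m \<ge> max (max 1 (2 * cmod z)) ((1 - Re (q 0)) / \<epsilon>)"
      using R unfolding filterlim_at_top by blast
    ultimately have "\<forall>\<^sub>F m in sequentially. cmod (q z - q 0) \<le> e"
    proof eventually_elim
      case (elim m)
      have Rm: "R m \<ge> 1" "R m \<ge> 2 * cmod z" "1 - Re (q 0) \<le> \<epsilon> * R m"
        using elim(2) \<epsilon> by (auto simp: divide_le_eq mult.commute)
      have Re_q: "Re (q u) < \<epsilon> * R m + 1" if "cmod u < R m" for u
      proof -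
        have "cmod (exp (q u)) \<le> exp (\<epsilon> * R m)" using elim(1) q(2) that by auto
        thus ?thesis by simp
      qed
      have "cmod (q z - q 0) \<le> 2 * ((\<epsilon> * R m + 1) - Re (q 0)) * cmod z / (R m - cmod z)"
      proof (rule borel_caratheodory)
        show "q holomorphic_on ball 0 (R m)" using q(1) by (rule holomorphic_on_subset) auto
      qed (use Rm Re_q in auto)
      also have "\<dots> \<le> 2 * (2 * (\<epsilon> * R m)) * cmod z / (R m / 2)"
        using Rm \<epsilon> Re_q[of 0] by (intro frac_le mult_mono) auto
      also have "\<dots> = 8 * cmod z * \<epsilon>" using Rm by simp
      also have "\<dots> \<le> (8 * cmod z + 1) * \<epsilon>" using \<epsilon> by (intro mult_right_mono) auto
      also have "\<dots> = e" unfolding \<epsilon>_def using norm_ge_zero[of z] by (simp add: add_nonneg_eq_0_iff)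
      finally show ?case .
    qed
    thus ?thesis by simp
  qed
  hence "cmod (q z - q 0) \<le> 0" by (rule field_le_epsilon[of _ 0, simplified])
  thus ?thesis using q(2) by (metis eq_iff_diff_eq_0 norm_le_zero_iff)
qed

section \<open>Independence of exponentials over subexponential coefficients\<close>

text \<open>
  Compactness of the unit circle: the rotation by \<open>u / v\<close> carries \<open>v\<close> to \<open>u\<close>, and it carries a whole
  neighbourhood of \<open>v\<close> into the arc.
\<close>

lemma finite_rotations_into_arc:
  assumes "\<eta> > 0" "cmod u = 1"
  obtains \<Phi> where "finite \<Phi>" "\<And>\<phi>. \<phi> \<in> \<Phi> \<Longrightarrow> cmod \<phi> = 1" "\<And>v. cmod v = 1 \<Longrightarrow> \<exists>\<phi>\<in>\<Phi>. cmod (\<phi> * v - u) < \<eta>"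
proof -
  define A where "A = (\<lambda>\<phi>. {v. cmod (\<phi> * v - u) < \<eta>})"
  have "open (A \<phi>)" for \<phi> unfolding A_def by (intro open_Collect_less continuous_intros)
  moreover have "sphere 0 1 \<subseteq> (\<Union>\<phi>\<in>sphere 0 1. A \<phi>)"
  proof
    fix v :: complex assume "v \<in> sphere 0 1"
    hence "v \<noteq> 0" "u / v \<in> sphere 0 1" using assms(2) by (auto simp: norm_divide)
    moreover from this have "v \<in> A (u / v)" using assms(1) by (simp add: A_def)
    ultimately show "v \<in> (\<Union>\<phi>\<in>sphere 0 1. A \<phi>)" by blast
  qed
  ultimately obtain \<Phi> where "\<Phi> \<subseteq> sphere 0 1" "finite \<Phi>" "sphere 0 1 \<subseteq> (\<Union>\<phi>\<in>\<Phi>. A \<phi>)"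
    using compactE_image[OF compact_sphere[of "0::complex" 1], of "sphere 0 1" A] by metis
  thus ?thesis using that[of \<Phi>] unfolding A_def by (auto simp: subset_iff)
qed

text \<open>
  Let \<open>u\<close> be the direction of \<open>cnj \<beta>1\<close>. Since \<open>\<beta>1\<close> has maximal modulus,
  \<open>Re (\<beta> u) < Re (\<beta>1 u)\<close> for every other exponent, so dividing the relation by \<open>exp (\<beta>1 z)\<close> shows that
  \<open>P \<beta>1\<close> decays exponentially on a sector around \<open>u\<close>. To carry the decay to an arbitrary point \<open>z0\<close>,
  multiply finitely many rotated copies of \<open>P \<beta>1\<close> about \<open>z0\<close>: at each point of a large circle one
  copy is evaluated in the sector and the others grow subexponentially, so the product is small there
  and, by the maximum principle, at the centre. This is an elementary substitute for the two-constants theorem.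
\<close>

lemma extreme_exponent_coefficient_vanishes:
  fixes P :: "complex \<Rightarrow> complex \<Rightarrow> complex" and S :: "complex set" and R :: "nat \<Rightarrow> real"
  assumes R: "filterlim R at_top sequentially" and S: "finite S"
    and hol: "\<And>\<beta>. \<beta> \<in> S \<Longrightarrow> P \<beta> holomorphic_on UNIV"
    and sub: "\<And>\<beta>. \<beta> \<in> S \<Longrightarrow> subexponential_along R (P \<beta>)"
    and sum0: "\<And>z. (\<Sum>\<beta>\<in>S. P \<beta> z * exp (\<beta> * z)) = 0"
    and \<beta>1: "\<beta>1 \<in> S" and max: "\<And>\<beta>. \<beta> \<in> S \<Longrightarrow> cmod \<beta> \<le> cmod \<beta>1"
  shows "P \<beta>1 z0 = 0"
proof -
  define u where "u = (if \<beta>1 = 0 then 1 else cnj \<beta>1 / of_real (cmod \<beta>1))"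
  have u: "cmod u = 1" by (simp add: u_def norm_divide)
  have neg: "Re ((\<beta> - \<beta>1) * u) < 0" if "\<beta> \<in> S" "\<beta> \<noteq> \<beta>1" for \<beta>
  proof (rule ccontr)
    assume "\<not> Re ((\<beta> - \<beta>1) * u) < 0"
    hence ge: "Re (\<beta> * u) \<ge> Re (\<beta>1 * u)" by (simp add: algebra_simps)
    have "\<beta>1 \<noteq> 0" using max[OF that(1)] that(2) by auto
    have b1: "\<beta>1 * u = of_real (cmod \<beta>1)"
      using \<open>\<beta>1 \<noteq> 0\<close> by (simp add: u_def complex_norm_square[symmetric] power2_eq_square)
    have cm: "cmod (\<beta> * u) = cmod \<beta>" by (simp add: norm_mult u)
    have "Re (\<beta> * u) = cmod (\<beta> * u)"
      using ge b1 cm max[OF that(1)] complex_Re_le_cmod[of "\<beta> * u"] by simp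
    moreover from this have "Im (\<beta> * u) = 0" by (metis add_cancel_right_right cmod_power2 zero_eq_power2)
    ultimately have "\<beta> * u = \<beta>1 * u"
      using ge b1 cm max[OF that(1)] by (simp add: complex_eq_iff)
    thus False using that(2) u by auto
  qed
  obtain \<delta> where \<delta>: "\<delta> > 0" "\<And>\<beta>. \<beta> \<in> S \<Longrightarrow> \<beta> \<noteq> \<beta>1 \<Longrightarrow> Re ((\<beta> - \<beta>1) * u) \<le> - (2 * \<delta>)"
  proof
    define d where "d = Min (insert 1 ((\<lambda>\<beta>. - Re ((\<beta> - \<beta>1) * u)) ` (S - {\<beta>1}))) / 2"
    show "d > 0" unfolding d_def using S neg by (subst divide_pos_pos) (auto simp: Min_gr_iff)
    fix \<beta> assume "\<beta> \<in> S" "\<beta> \<noteq> \<beta>1"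
    hence "2 * d \<le> - Re ((\<beta> - \<beta>1) * u)" unfolding d_def using S by (auto intro!: Min_le)
    thus "Re ((\<beta> - \<beta>1) * u) \<le> - (2 * d)" by simp
  qed
  \<comment> \<open>Since \<open>|\<beta> - \<beta>1| \<le> 2 |\<beta>1|\<close>, turning \<open>u\<close> by \<open>\<eta>\<close> loses at most \<open>\<delta>\<close> of the decay rate \<open>2 \<delta>\<close>.\<close>
  define \<eta> where "\<eta> = \<delta> / (2 * cmod \<beta>1 + 1)"
  have \<eta>: "\<eta> > 0" unfolding \<eta>_def using \<delta> by (intro divide_pos_pos) (auto intro: add_nonneg_pos)
  obtain \<Phi> where \<Phi>: "finite \<Phi>" "\<And>\<phi>. \<phi> \<in> \<Phi> \<Longrightarrow> cmod \<phi> = 1" "\<And>v. cmod v = 1 \<Longrightarrow> \<exists>\<phi>\<in>\<Phi>. cmod (\<phi> * v - u) < \<eta>"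
    using finite_rotations_into_arc[OF \<eta> u] by blast
  have "\<Phi> \<noteq> {}" using \<Phi>(3)[of 1] by auto
  define N where "N = card \<Phi>"
  have N: "N > 0" unfolding N_def using \<Phi>(1) \<open>\<Phi> \<noteq> {}\<close> by (simp add: card_gt_0_iff)
  \<comment> \<open>The \<open>N\<close> factors together grow at rate at most \<open>\<delta> / 2\<close>, half of the decay of the small one.\<close>
  define \<epsilon> where "\<epsilon> = \<delta> / (2 * real N)"
  have \<epsilon>: "\<epsilon> > 0" "real N * \<epsilon> = \<delta> / 2" unfolding \<epsilon>_def using \<delta> N by auto
  define K where "K = (\<Sum>\<beta>\<in>S - {\<beta>1}. exp (cmod (\<beta> - \<beta>1) * cmod z0))"
  have K: "K \<ge> 0" unfolding K_def by (intro sum_nonneg) auto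
  define G where "G = (\<lambda>z. \<Prod>\<phi>\<in>\<Phi>. P \<beta>1 (z0 + \<phi> * z))"
  have P1_hol: "(\<lambda>z. P \<beta>1 (z0 + \<phi> * z)) holomorphic_on UNIV" for \<phi>
  proof -
    have "(\<lambda>z. z0 + \<phi> * z) holomorphic_on UNIV" by (intro holomorphic_intros)
    from holomorphic_on_compose_gen[OF this hol[OF \<beta>1]] show ?thesis by (simp add: o_def)
  qed
  have G_hol: "G holomorphic_on UNIV" unfolding G_def by (intro holomorphic_intros P1_hol)
  have "\<forall>\<^sub>F m in sequentially. \<forall>\<beta>\<in>S. \<forall>z. cmod z \<le> R m + cmod z0 \<longrightarrow> cmod (P \<beta> z) \<le> exp (\<epsilon> * R m)"
    using S subexponential_alongD[OF sub \<epsilon>(1)] by (intro eventually_ball_finite) auto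
  moreover have "\<forall>\<^sub>F m in sequentially. R m \<ge> 1" using R by (simp add: filterlim_at_top)
  ultimately have main: "\<forall>\<^sub>F m in sequentially. cmod (P \<beta>1 z0) ^ N \<le> K * exp (- (\<delta> / 2) * R m)"
  proof eventually_elim
    case (elim m)
    have bound: "cmod (P \<beta> (z0 + y)) \<le> exp (\<epsilon> * R m)" if "\<beta> \<in> S" "cmod y \<le> R m" for \<beta> y
      using elim(1) that norm_triangle_ineq[of z0 y] by fastforce
    have "cmod (G 0) \<le> K * exp (- (\<delta> / 2) * R m)"
    proof (rule maximum_modulus_frontier[of G "cball 0 (R m)"])
      show "G holomorphic_on interior (cball 0 (R m))" using G_hol by (rule holomorphic_on_subset) auto
      show "continuous_on (closure (cball 0 (R m))) G"
        using holomorphic_on_imp_continuous_on[OF G_hol] by (rule continuous_on_subset) auto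
      fix z :: complex assume "z \<in> frontier (cball 0 (R m))"
      hence z: "cmod z = R m" using elim(2) by auto
      define v where "v = z / of_real (R m)"
      have v: "cmod v = 1" "z = of_real (R m) * v" using z elim(2) by (auto simp: v_def norm_divide)
      obtain \<phi> where \<phi>: "\<phi> \<in> \<Phi>" "cmod (\<phi> * v - u) < \<eta>" using \<Phi>(3)[OF v(1)] by blast
      have cz: "cmod (\<psi> * z) = R m" if "\<psi> \<in> \<Phi>" for \<psi> using \<Phi>(2)[OF that] z by (simp add: norm_mult)
      have decay: "cmod (exp ((\<beta> - \<beta>1) * (z0 + \<phi> * z))) \<le> exp (cmod (\<beta> - \<beta>1) * cmod z0) * exp (- \<delta> * R m)"
        if "\<beta> \<in> S - {\<beta>1}" for \<beta>
      proof -
        have "cmod (\<beta> - \<beta>1) \<le> 2 * cmod \<beta>1 + 1"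
          using norm_triangle_ineq4[of \<beta> \<beta>1] max[of \<beta>] that by auto
        hence "cmod (\<beta> - \<beta>1) * cmod (\<phi> * v - u) \<le> (2 * cmod \<beta>1 + 1) * \<eta>"
          using \<phi>(2) by (intro mult_mono) auto
        also have "\<dots> = \<delta>" unfolding \<eta>_def using norm_ge_zero[of \<beta>1] by (simp add: add_nonneg_eq_0_iff)
        finally have "Re ((\<beta> - \<beta>1) * (\<phi> * v - u)) \<le> \<delta>"
          using complex_Re_le_cmod[of "(\<beta> - \<beta>1) * (\<phi> * v - u)"] by (simp only: norm_mult) 
        moreover have "(\<beta> - \<beta>1) * (\<phi> * v) = (\<beta> - \<beta>1) * u + (\<beta> - \<beta>1) * (\<phi> * v - u)" by (simp add: algebra_simps)
        ultimately have "Re ((\<beta> - \<beta>1) * (\<phi> * v)) \<le> - \<delta>" using \<delta>(2)[of \<beta>] that by (simp only: plus_complex.sel) auto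
        hence "R m * Re ((\<beta> - \<beta>1) * (\<phi> * v)) \<le> R m * (- \<delta>)" using elim(2) by (intro mult_left_mono) auto
        moreover have "Re ((\<beta> - \<beta>1) * (\<phi> * z)) = R m * Re ((\<beta> - \<beta>1) * (\<phi> * v))"
          unfolding v(2) by (simp add: algebra_simps)
        moreover have "Re ((\<beta> - \<beta>1) * z0) \<le> cmod (\<beta> - \<beta>1) * cmod z0"
          using complex_Re_le_cmod[of "(\<beta> - \<beta>1) * z0"] by (simp only: norm_mult)
        ultimately have "Re ((\<beta> - \<beta>1) * (z0 + \<phi> * z)) \<le> cmod (\<beta> - \<beta>1) * cmod z0 + - \<delta> * R m"
          unfolding distrib_left plus_complex.sel by (simp add: mult.commute)
        thus ?thesis unfolding norm_exp_eq_Re exp_add[symmetric] by (simp only: exp_le_cancel_iff)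
      qed
      have "P \<beta>1 y = - (\<Sum>\<beta>\<in>S - {\<beta>1}. P \<beta> y * exp ((\<beta> - \<beta>1) * y))" for y
      proof -
        have "0 = (\<Sum>\<beta>\<in>S. P \<beta> y * exp (\<beta> * y)) * exp (- \<beta>1 * y)" using sum0 by simp
        also have "\<dots> = (\<Sum>\<beta>\<in>S. P \<beta> y * exp ((\<beta> - \<beta>1) * y))"
          unfolding sum_distrib_right mult.assoc exp_add[symmetric] by (simp add: algebra_simps)
        also have "\<dots> = P \<beta>1 y + (\<Sum>\<beta>\<in>S - {\<beta>1}. P \<beta> y * exp ((\<beta> - \<beta>1) * y))"
          using sum.remove[OF S \<beta>1, of "\<lambda>\<beta>. P \<beta> y * exp ((\<beta> - \<beta>1) * y)"] by simp
        finally show ?thesis by (simp add: eq_neg_iff_add_eq_0)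
      qed
      hence "cmod (P \<beta>1 (z0 + \<phi> * z)) = cmod (\<Sum>\<beta>\<in>S - {\<beta>1}. P \<beta> (z0 + \<phi> * z) * exp ((\<beta> - \<beta>1) * (z0 + \<phi> * z)))"
        by (metis norm_minus_cancel)
      also have "\<dots> \<le> (\<Sum>\<beta>\<in>S - {\<beta>1}. exp (\<epsilon> * R m) * (exp (cmod (\<beta> - \<beta>1) * cmod z0) * exp (- \<delta> * R m)))"
      proof (rule sum_norm_le)
        fix \<beta> assume \<beta>: "\<beta> \<in> S - {\<beta>1}"
        show "cmod (P \<beta> (z0 + \<phi> * z) * exp ((\<beta> - \<beta>1) * (z0 + \<phi> * z))) \<le> exp (\<epsilon> * R m) * (exp (cmod (\<beta> - \<beta>1) * cmod z0) * exp (- \<delta> * R m))"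
          unfolding norm_mult using bound[of \<beta> "\<phi> * z"] cz[OF \<phi>(1)] \<beta> decay[OF \<beta>] by (intro mult_mono) auto
      qed
      also have "\<dots> = exp (\<epsilon> * R m) * K * exp (- \<delta> * R m)"
        by (simp add: K_def sum_distrib_left sum_distrib_right mult.assoc)
      finally have small: "cmod (P \<beta>1 (z0 + \<phi> * z)) \<le> exp (\<epsilon> * R m) * K * exp (- \<delta> * R m)" .
      have "cmod (G z) = cmod (P \<beta>1 (z0 + \<phi> * z)) * (\<Prod>\<psi>\<in>\<Phi> - {\<phi>}. cmod (P \<beta>1 (z0 + \<psi> * z)))"
        unfolding G_def by (simp add: prod.remove[OF \<Phi>(1) \<phi>(1)] norm_mult prod_norm)
      also have "\<dots> \<le> (exp (\<epsilon> * R m) * K * exp (- \<delta> * R m)) * (\<Prod>\<psi>\<in>\<Phi> - {\<phi>}. exp (\<epsilon> * R m))"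
        using small bound[OF \<beta>1] cz K by (intro mult_mono prod_mono prod_nonneg) auto
      also have "(\<Prod>\<psi>\<in>\<Phi> - {\<phi>}. exp (\<epsilon> * R m)) = exp (real (N - 1) * (\<epsilon> * R m))"
        using \<phi>(1) \<Phi>(1) by (simp add: N_def exp_of_nat_mult)
      also have "(exp (\<epsilon> * R m) * K * exp (- \<delta> * R m)) * exp (real (N - 1) * (\<epsilon> * R m)) 
          = K * exp (\<epsilon> * R m + - \<delta> * R m + real (N - 1) * (\<epsilon> * R m))"
        by (simp only: exp_add mult_ac)
      also have "\<epsilon> * R m + - \<delta> * R m + real (N - 1) * (\<epsilon> * R m) = (real N * \<epsilon>) * R m - \<delta> * R m"
        using N by (simp add: of_nat_diff algebra_simps)
      also have "\<dots> = - (\<delta> / 2) * R m" unfolding \<epsilon>(2) by (simp add: algebra_simps)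
      finally show "cmod (G z) \<le> K * exp (- (\<delta> / 2) * R m)" .
    qed (use elim(2) in auto)
    thus "cmod (P \<beta>1 z0) ^ N \<le> K * exp (- (\<delta> / 2) * R m)" by (simp add: G_def N_def norm_power)
  qed
  have "filterlim (\<lambda>m. - (\<delta> / 2) * R m) at_bot sequentially"
    by (rule filterlim_tendsto_neg_mult_at_bot[OF tendsto_const _ R]) (use \<delta> in auto)
  hence "(\<lambda>m. exp (- (\<delta> / 2) * R m)) \<longlonglongrightarrow> 0" by (rule filterlim_compose[OF exp_at_bot])
  hence "(\<lambda>m. K * exp (- (\<delta> / 2) * R m)) \<longlonglongrightarrow> 0" by (rule tendsto_mult_right_zero)
  hence "cmod (P \<beta>1 z0) ^ N \<le> 0" by (rule tendsto_lowerbound[OF _ main]) auto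
  thus ?thesis by (metis norm_eq_zero norm_ge_zero not_less zero_less_power less_eq_real_def)
qed

text \<open>
  Coefficients are removed one at a time, always that of an exponent of maximal modulus.
\<close>

lemma exponentials_independent_over_subexponential:
  fixes P :: "complex \<Rightarrow> complex \<Rightarrow> complex" and S :: "complex set" and R :: "nat \<Rightarrow> real"
  assumes R: "filterlim R at_top sequentially" and S: "finite S"
    and "\<And>\<beta>. \<beta> \<in> S \<Longrightarrow> P \<beta> holomorphic_on UNIV"
    and "\<And>\<beta>. \<beta> \<in> S \<Longrightarrow> subexponential_along R (P \<beta>)"
    and "\<And>z. (\<Sum>\<beta>\<in>S. P \<beta> z * exp (\<beta> * z)) = 0"
    and "\<beta> \<in> S"
  shows "P \<beta> z = 0"
  using S assms(3-)
proof (induction S arbitrary: \<beta> z rule: finite_psubset_induct)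
  case (psubset S)
  have "Max (cmod ` S) \<in> cmod ` S" using psubset.hyps psubset.prems(4) by (intro Max_in) auto
  then obtain \<beta>1 where \<beta>1: "\<beta>1 \<in> S" "cmod \<beta>1 = Max (cmod ` S)" by auto
  hence max: "cmod \<beta>' \<le> cmod \<beta>1" if "\<beta>' \<in> S" for \<beta>' using that psubset.hyps by simp
  have zero: "P \<beta>1 y = 0" for y
    by (rule extreme_exponent_coefficient_vanishes[OF R psubset.hyps psubset.prems(1-3) \<beta>1(1) max])
  show ?case
  proof (cases "\<beta> = \<beta>1")
    case False
    show ?thesis
    proof (rule psubset.IH[of "S - {\<beta>1}"])
      show "(\<Sum>\<beta>\<in>S - {\<beta>1}. P \<beta> y * exp (\<beta> * y)) = 0" for y
        using psubset.prems(3)[of y] zero psubset.hyps \<beta>1(1) by (simp add: sum.remove)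
    qed (use psubset.prems \<beta>1 False in auto)
  qed (use zero in simp)
qed

section \<open>The solutions of the differential-difference equation\<close>

text \<open>
  In the equation, regarded as a relation between exponentials with exponents \<open>n a\<close>, \<open>a\<close>, \<open>\<alpha> 1\<close>,
  \<open>\<alpha> 2\<close>, coinciding exponents have to be collected first; the collected coefficient of each
  is the function \<open>q\<close> below and vanishes. An \<open>\<alpha> i\<close> outside \<open>{a, n a}\<close> would have the coefficient
  \<open>- p i \<noteq> 0\<close>.
\<close>

lemma coefficient_identification:
  fixes f :: "complex \<Rightarrow> complex" and p \<alpha> :: "nat \<Rightarrow> complex" and R :: "nat \<Rightarrow> real"
  assumes n: "n \<ge> 2" and R: "filterlim R at_top sequentially"
    and f: "f holomorphic_on UNIV"
    and p: "p 1 \<noteq> 0" "p 2 \<noteq> 0" and \<alpha>: "\<alpha> 1 \<noteq> 0" "\<alpha> 2 \<noteq> 0" "\<alpha> 1 \<noteq> \<alpha> 2"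
    and equation: "\<And>z. f z ^ n + w * f z ^ (n - 1) * deriv f z + (deriv ^^ k) f (z + c)
                        = p 1 * exp (\<alpha> 1 * z) + p 2 * exp (\<alpha> 2 * z)"
    and sub: "subexponential_along R (\<lambda>z. f z * exp (- a * z))"
  obtains i j where "i \<in> {1, 2}" "j \<in> {1, 2}" "i \<noteq> j" "a = \<alpha> i" "of_nat n * a = \<alpha> j"
    "\<And>z. (f z ^ n + w * f z ^ (n - 1) * deriv f z) * exp (- \<alpha> j * z) = p j"
proof -
  define b where "b = of_nat n * a"
  define P where "P = (\<lambda>z. (f z ^ n + w * f z ^ (n - 1) * deriv f z) * exp (- b * z))"
  define H where "H = (\<lambda>z. (deriv ^^ k) f (z + c) * exp (- a * z))"
  define h where "h = (\<lambda>z. f z * exp (- a * z))"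
  define d where "d = (\<lambda>z. deriv f z * exp (- a * z))"
  define q where "q = (\<lambda>\<beta> z. (if \<beta> = b then P z else 0) + (if \<beta> = a then H z else 0)
     + (if \<beta> = \<alpha> 1 then - p 1 else 0) + (if \<beta> = \<alpha> 2 then - p 2 else 0))"
  define S where "S = {b, a, \<alpha> 1, \<alpha> 2}"
  have shift_hol: "(\<lambda>z. (deriv ^^ k) f (z + c)) holomorphic_on UNIV"
  proof -
    have "(\<lambda>z. z + c) holomorphic_on UNIV" by (intro holomorphic_intros)
    from holomorphic_on_compose_gen[OF this holomorphic_higher_deriv[OF f open_UNIV]] show ?thesis by (simp add: o_def)
  qed
  have P_hol: "P holomorphic_on UNIV" and H_hol: "H holomorphic_on UNIV"
    unfolding P_def H_def by (intro holomorphic_intros f shift_hol open_UNIV)+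
  \<comment> \<open>The exponent \<open>n a\<close> is distributed over the \<open>n\<close> factors, each of which is subexponential.\<close>
  have P_eq: "P z = h z ^ n + w * h z ^ (n - 1) * d z" for z
  proof -
    obtain m where m: "n = Suc m" using n by (cases n) auto
    have e: "exp (- b * z) = exp (- a * z) ^ m * exp (- a * z)"
      unfolding b_def m by (simp flip: exp_of_nat_mult exp_add add: algebra_simps)
    show ?thesis unfolding P_def h_def d_def e by (simp add: m power_mult_distrib algebra_simps)
  qed
  have d_sub: "subexponential_along R d"
    using subexponential_along_higher_deriv_shift[OF R f sub, of 1 0] by (simp add: d_def)
  have P_sub: "subexponential_along R P" unfolding P_eq
    using sub d_sub unfolding h_def[symmetric]
    by (intro subexponential_along_add subexponential_along_mult subexponential_along_power subexponential_along_const R)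
  have H_sub: "subexponential_along R H" unfolding H_def
    by (rule subexponential_along_higher_deriv_shift[OF R f sub])
  have q_zero: "q \<beta> z = 0" if "\<beta> \<in> S" for \<beta> z
  proof (rule exponentials_independent_over_subexponential[OF R, of S q])
    show "q \<beta> holomorphic_on UNIV" for \<beta>
    proof -
      have "(\<lambda>z. if \<beta> = b then P z else 0) holomorphic_on UNIV" "(\<lambda>z. if \<beta> = a then H z else 0) holomorphic_on UNIV"
        using P_hol H_hol by (cases "\<beta> = b"; cases "\<beta> = a"; simp)+
      thus ?thesis unfolding q_def by (intro holomorphic_intros)
    qed
    show "subexponential_along R (q \<beta>)" for \<beta>
    proof -
      have "subexponential_along R (\<lambda>z. if \<beta> = b then P z else 0)" "subexponential_along R (\<lambda>z. if \<beta> = a then H z else 0)"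
        using P_sub H_sub subexponential_along_const[OF R, of 0] by (cases "\<beta> = b"; cases "\<beta> = a"; simp)+
      thus ?thesis unfolding q_def by (intro subexponential_along_add subexponential_along_const R)
    qed
    fix z
    have "(\<Sum>\<beta>\<in>S. q \<beta> z * exp (\<beta> * z)) = P z * exp (b * z) + H z * exp (a * z) - p 1 * exp (\<alpha> 1 * z) - p 2 * exp (\<alpha> 2 * z)"
    proof -
      have pick: "(\<Sum>\<beta>\<in>S. (if \<beta> = x then y else 0) * exp (\<beta> * z)) = y * exp (x * z)" if "x \<in> S" for x y
      proof -
        have "(\<Sum>\<beta>\<in>S. (if \<beta> = x then y else 0) * exp (\<beta> * z)) = (\<Sum>\<beta>\<in>S. if \<beta> = x then y * exp (x * z) else 0)"
          by (intro sum.cong) auto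
        thus ?thesis using that by (simp add: S_def)
      qed
      show ?thesis unfolding q_def distrib_right sum.distrib using pick[of b "P z"] pick[of a "H z"] pick[of "\<alpha> 1" "- p 1"] pick[of "\<alpha> 2" "- p 2"]
        by (simp add: S_def)
    qed
    also have "P z * exp (b * z) = f z ^ n + w * f z ^ (n - 1) * deriv f z"
      unfolding P_def mult.assoc exp_add[symmetric] by simp
    also have "H z * exp (a * z) = (deriv ^^ k) f (z + c)"
      unfolding H_def mult.assoc exp_add[symmetric] by simp
    finally show "(\<Sum>\<beta>\<in>S. q \<beta> z * exp (\<beta> * z)) = 0" using equation[of z] by simp
  qed (use that in \<open>auto simp: S_def\<close>)
  have in_ab: "\<alpha> i = b \<or> \<alpha> i = a" if "i \<in> {1, 2}" for i
    using q_zero[of "\<alpha> i" 0] that p \<alpha> by (auto simp: S_def q_def split: if_splits)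
  have "a \<noteq> b" using in_ab[of 1] in_ab[of 2] \<alpha> by auto
  show ?thesis
  proof (cases "\<alpha> 1 = a")
    case True
    hence b: "\<alpha> 2 = b" using in_ab[of 2] \<alpha> by auto
    have "P z = p 2" for z using q_zero[of b z] \<open>a \<noteq> b\<close> b True \<alpha> by (auto simp: S_def q_def)
    thus ?thesis using that[of 1 2] True b unfolding P_def b_def by auto
  next
    case False
    hence b: "\<alpha> 1 = b" "\<alpha> 2 = a" using in_ab[of 1] in_ab[of 2] \<alpha> by auto
    have "P z = p 1" for z using q_zero[of b z] \<open>a \<noteq> b\<close> b \<alpha> by (auto simp: S_def q_def)
    thus ?thesis using that[of 2 1] b unfolding P_def b_def by auto
  qed
qed

theorem theorem3:
  fixes n k :: nat and c w :: complex and p \<alpha> :: "nat \<Rightarrow> complex"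
    and f :: "complex \<Rightarrow> complex"
  assumes n: "n = 4 \<or> n = 3"
    and w: "w \<noteq> 0"
    and p: "p 1 \<noteq> 0" "p 2 \<noteq> 0"
    and \<alpha>: "\<alpha> 1 \<noteq> 0" "\<alpha> 2 \<noteq> 0" "\<alpha> 1 \<noteq> \<alpha> 2"
    and f: "transcendental_entire f"
    and finite_order: "growth_order f < \<infinity>"
    and equation: "\<And>z. f z ^ n + w * f z ^ (n - 1) * deriv f z + (deriv ^^ k) f (z + c)
                        = p 1 * exp (\<alpha> 1 * z) + p 2 * exp (\<alpha> 2 * z)"
    and few_zeros: "small_growth (\<lambda>r. nevanlinna_N r (\<lambda>z. 1 / f z)) f"
  shows "\<exists>a C. a \<noteq> 0 \<and> C \<noteq> 0 \<and> (\<forall>z. f z = C * exp (a * z)) \<and>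
           (\<exists>i \<in> {1, 2}. \<exists>j \<in> {1, 2}. i \<noteq> j \<and> a = \<alpha> i \<and> of_nat n * a = \<alpha> j \<and>
              1 + a * w \<noteq> 0 \<and>
              (\<exists>u v. u ^ n = 1 / (1 + a * w) \<and> v ^ n = p j \<and> C = u * v))"
proof -
  have n2: "n \<ge> 2" using n by auto
  have hol: "f holomorphic_on UNIV" using f by (simp add: transcendental_entire_def)
  obtain z0 where z0: "f z0 \<noteq> 0"
    using f unfolding transcendental_entire_def by (metis poly_0)
  obtain C K where CK: "C \<ge> 0" "\<And>z. cmod (f z) \<le> exp (C * (1 + cmod z) ^ K)"
    using finite_order_norm_bound[OF hol z0 finite_order] by blast
  define Q where "Q = cmod (p 1) + cmod (p 2) + cmod (\<alpha> 1) + cmod (\<alpha> 2)"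
  have Q: "Q \<ge> 0" by (simp add: Q_def)
  have rhs: "cmod (p 1 * exp (\<alpha> 1 * z) + p 2 * exp (\<alpha> 2 * z)) \<le> exp (Q * (1 + cmod z))" for z
  proof -
    define e where "e = exp ((cmod (\<alpha> 1) + cmod (\<alpha> 2)) * cmod z)"
    have e: "cmod (exp (\<alpha> i * z)) \<le> e" if "i \<in> {1, 2}" for i
    proof -
      have "Re (\<alpha> i * z) \<le> cmod (\<alpha> i) * cmod z" using complex_Re_le_cmod[of "\<alpha> i * z"] by (simp only: norm_mult)
      also have "\<dots> \<le> (cmod (\<alpha> 1) + cmod (\<alpha> 2)) * cmod z" using that by (intro mult_right_mono) auto
      finally show ?thesis by (simp add: e_def)
    qed
    have "cmod (p 1 * exp (\<alpha> 1 * z) + p 2 * exp (\<alpha> 2 * z)) \<le> cmod (p 1) * e + cmod (p 2) * e"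
      using e[of 1] e[of 2] by (intro norm_triangle_mono) (auto simp: norm_mult intro!: mult_left_mono)
    also have "\<dots> = (cmod (p 1) + cmod (p 2)) * e" by (simp add: algebra_simps)
    also have "\<dots> \<le> exp (cmod (p 1) + cmod (p 2)) * e"
    proof (rule mult_right_mono)
      show "cmod (p 1) + cmod (p 2) \<le> exp (cmod (p 1) + cmod (p 2))"
        using exp_ge_add_one_self[of "cmod (p 1) + cmod (p 2)"] by linarith
    qed (simp add: e_def)
    also have "\<dots> \<le> exp (Q * (1 + cmod z))"
      unfolding e_def exp_add[symmetric] Q_def by (simp add: algebra_simps)
    finally show ?thesis .
  qed
  obtain D where D: "D \<ge> 0"
    "\<And>r X z. \<lbrakk>1 \<le> X; \<And>u. cmod u \<le> r + (cmod c + 1) \<Longrightarrow> cmod (f u) \<le> X; cmod z \<le> r\<rbrakk>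
        \<Longrightarrow> cmod (f z) ^ n \<le> exp (D * (r + 1)) * X"
    using differential_difference_growth_step[OF hol w Q equation rhs] by blast
  define A where "A = D * (1 + (cmod c + 1))"
  have A: "A \<ge> 0" unfolding A_def using D(1) by simp
  have type: "cmod (f z) \<le> exp (A * (1 + cmod z))" for z
    unfolding A_def by (rule exponential_type_of_growth_step[OF n2 _ CK(1) D(1) CK(2) D(2)]) simp_all
  obtain R a where R: "filterlim R at_top sequentially" and sub: "subexponential_along R (\<lambda>z. f z * exp (- a * z))"
    using subexponential_after_exponential_factor[OF hol z0 A type few_zeros] by blast
  obtain i j where ij: "i \<in> {1, 2}" "j \<in> {1, 2}" "i \<noteq> j" "a = \<alpha> i" "of_nat n * a = \<alpha> j"
    and leading: "\<And>z. (f z ^ n + w * f z ^ (n - 1) * deriv f z) * exp (- \<alpha> j * z) = p j"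
    using coefficient_identification[OF n2 R hol p \<alpha> equation sub] by metis
  have pj: "p j \<noteq> 0" using p ij(2) by auto
  \<comment> \<open>\<open>f z ^ (n - 1)\<close> divides the left-hand side of \<open>leading\<close>.\<close>
  have nz: "f z \<noteq> 0" for z using leading[of z] pj n by auto
  define C where "C = f 0"
  have "f z * exp (- a * z) = f 0 * exp (- a * 0)" for z
    by (rule nonvanishing_subexponential_constant[OF R _ _ sub]) (use nz hol in \<open>auto intro!: holomorphic_intros\<close>)
  hence quotient: "f z * exp (- a * z) = C" for z by (simp only: C_def mult_zero_right exp_zero mult_1_right)
  have f_eq: "f z = C * exp (a * z)" for z
    unfolding quotient[of z, symmetric] mult.assoc exp_add[symmetric] by simp
  have "deriv f 0 = C * a"
  proof -
    have "f = (\<lambda>z. C * exp (a * z))" using f_eq by blast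
    hence "deriv f 0 = deriv (\<lambda>z. C * exp (a * z)) 0" by (rule arg_cong)
    also have "\<dots> = C * a" by (rule DERIV_imp_deriv) (auto intro!: derivative_eq_intros)
    finally show ?thesis .
  qed
  moreover have "C ^ n = C ^ (n - 1) * C" using n by (auto simp: power_eq_if)
  ultimately have Cn: "C ^ n * (1 + a * w) = p j"
    using leading[of 0] unfolding C_def[symmetric] by (simp add: algebra_simps)
  have aw: "1 + a * w \<noteq> 0" using Cn pj by auto
  have C0: "C \<noteq> 0" using nz by (simp add: C_def)
  obtain v where v: "v ^ n = p j"
  proof
    show "exp (Ln (p j) / of_nat n) ^ n = p j"
      using pj n2 by (simp add: exp_divide_power_eq)
  qed
  have v0: "v \<noteq> 0" using v pj n2 by (auto simp: zero_power)
  have "(C / v) ^ n = 1 / (1 + a * w)" using Cn v aw pj by (simp add: power_divide field_simps)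
  moreover have "C = C / v * v" using v0 by simp
  moreover have "a \<noteq> 0" using ij(1,4) \<alpha> by auto
  ultimately show ?thesis using C0 f_eq ij aw v by blast
qed

end
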